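(* Let $p>2$ be a prime and let $d>1$ be a divisor of $p-1$. Then $\mathbf{Ab}(p)*\mathbf{Ab}(d)=\langle G_{p,d}\rangle$. Moreover, $G_{p,d}$ is, up to isomorphism, the unique generator of minimum size of $\mathbf{Ab}(p)*\mathbf{Ab}(d)$ (i.e. the unique finite group of minimum order among the finite groups $H$ with $\langle H\rangle=\mathbf{Ab}(p)*\mathbf{Ab}(d)$).
   Context: A pseudovariety is a class of finite groups closed under taking subgroups, homomorphic images and finitary direct products. $\mathbf{Ab}(n)$ is the pseudovariety of finite abelian groups of exponent dividing $n$. For pseudovarieties $\mathbf{V},\mathbf{W}$, $\mathbf{V}*\mathbf{W}$ is the pseudovariety of all finite groups $G$ having a normal subgroup $N\in\mathbf{V}$ with $G/N\in\mathbf{W}$. For a finite group $G$, $\langle G\rangle$ is the pseudovariety generated by $G$, i.e. all homomorphic images of subgroups of finite direct powers of $G$. $G_{p,d}$ denotes the group presented by $\langle x,y\mid x^p=1,\ y^d=1,\ yxy^{-1}=x^q\rangle$, where $q\in\{1,\dots,p-1\}$ has multiplicative order exactly $d$ in $\mathbb{F}_p^*$ (up to isomorphism this does not depend on the choice of $q$). *)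

theory Defs
  imports "HOL-Algebra.Product_Groups" "HOL-Number_Theory.Number_Theory"
begin

section \<open>Pseudovarieties of finite groups\<close>

text \<open>
  Every finite group is isomorphic to one whose carrier is a set of natural numbers, and all
  the classes below are closed under isomorphism.  A class of finite groups is therefore
  represented by its members of type \<^typ>\<open>nat monoid\<close>.
\<close>

text \<open>The case \<open>n = 0\<close> of the last clause (the empty product) puts the trivial groups in
  every pseudovariety.\<close>

definition pseudovariety :: "nat monoid set \<Rightarrow> bool" where
  "pseudovariety V \<longleftrightarrow>
     (\<forall>G\<in>V. group G \<and> finite (carrier G)) \<and>
     (\<forall>G\<in>V. \<forall>S. subgroup S G \<longrightarrow> G\<lparr>carrier := S\<rparr> \<in> V) \<and>
     (\<forall>G\<in>V. \<forall>K h. group K \<and> h \<in> epi G K \<longrightarrow> K \<in> V) \<and>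
     (\<forall>n F K. (\<forall>i<n. F i \<in> V) \<and> group K \<and> product_group {..<n::nat} F \<cong> K \<longrightarrow> K \<in> V)"

definition Ab :: "nat \<Rightarrow> nat monoid set" where
  "Ab n = {G. comm_group G \<and> finite (carrier G) \<and>
              (\<forall>x\<in>carrier G. x [^]\<^bsub>G\<^esub> n = \<one>\<^bsub>G\<^esub>)}"

text \<open>The quotient \<^term>\<open>G Mod N\<close> is a group of cosets, hence it is compared with the members
  of \<^term>\<open>W\<close> up to isomorphism.\<close>

definition pv_product :: "nat monoid set \<Rightarrow> nat monoid set \<Rightarrow> nat monoid set"
    (infixl \<open>\<^bold>*\<close> 70) where
  "V \<^bold>* W = {G. group G \<and> finite (carrier G) \<and>
                (\<exists>N. N \<lhd> G \<and> G\<lparr>carrier := N\<rparr> \<in> V \<and> (\<exists>Q\<in>W. G Mod N \<cong> Q))}"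

text \<open>The homomorphic images of subgroups of finite direct powers of \<open>G\<close>; for finite \<open>G\<close> this is the
  least pseudovariety containing the copies of \<open>G\<close>, see \<open>pseudovariety_pv_generated\<close>,
  \<open>pv_generated_contains\<close> and \<open>pv_generated_least\<close> below.\<close>

definition pv_generated :: "'a monoid \<Rightarrow> nat monoid set" where
  "pv_generated G = {K. group K \<and>
     (\<exists>(n::nat) S h. subgroup S (product_group {..<n} (\<lambda>_. G)) \<and>
        h \<in> epi ((product_group {..<n} (\<lambda>_. G))\<lparr>carrier := S\<rparr>) K)}"

definition min_generator :: "nat monoid set \<Rightarrow> 'a monoid \<Rightarrow> bool" where
  "min_generator V G \<longleftrightarrow>
     group G \<and> finite (carrier G) \<and> pv_generated G = V \<and>
     (\<forall>H :: nat monoid. group H \<and> finite (carrier H) \<and> pv_generated H = V \<longrightarrow> order G \<le> order H)"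


subsection \<open>The class generated by a group is the least pseudovariety containing it\<close>

lemma epi_compose_restrict:
  assumes "group A" "group B" "\<phi> \<in> hom A B" "subgroup S B" "S \<subseteq> \<phi> ` carrier A"
    and "h \<in> epi (B\<lparr>carrier := S\<rparr>) K"
  shows "\<exists>T. subgroup T A \<and> h \<circ> \<phi> \<in> epi (A\<lparr>carrier := T\<rparr>) K"
proof -
  define T where "T = {x \<in> carrier A. \<phi> x \<in> S}"
  interpret group_hom A B \<phi> using assms by (simp add: group_hom_def group_hom_axioms_def)
  have T: "subgroup T A"
  proof (rule G.subgroupI)
    show "T \<noteq> {}" using subgroup.one_closed[OF assms(4)] by (auto simp: T_def intro!: exI[of _ "\<one>\<^bsub>A\<^esub>"])
  qed (auto simp: T_def subgroup.m_closed[OF assms(4)] subgroup.m_inv_closed[OF assms(4)])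
  have im: "\<phi> ` T = S" using assms(5) by (auto simp: T_def)
  have "(h \<circ> \<phi>) ` T = carrier K"
    using assms(6) im unfolding image_comp[symmetric] by (simp add: epi_def)
  moreover have "h \<circ> \<phi> \<in> hom (A\<lparr>carrier := T\<rparr>) K"
    using assms(6) by (auto simp: epi_def hom_def Pi_iff T_def)
  ultimately have "h \<circ> \<phi> \<in> epi (A\<lparr>carrier := T\<rparr>) K" by (simp add: epi_def)
  with T show ?thesis by blast
qed

lemma pv_generatedI:
  assumes "group G" "finite I" "subgroup S (product_group I (\<lambda>_. G))" "group K"
    and "h \<in> epi ((product_group I (\<lambda>_. G))\<lparr>carrier := S\<rparr>) K"
  shows "K \<in> pv_generated G"
proof -
  obtain b where b: "bij_betw b {..<card I} I"
    using ex_bij_betw_nat_finite[OF assms(2)] by (auto simp: atLeast0LessThan)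
  define c where "c = inv_into {..<card I} b"
  have c: "c i < card I" "b (c i) = i" if "i \<in> I" for i
    using bij_betw_inv_into[OF b] bij_betw_inv_into_right[OF b that] that
    by (auto simp: c_def bij_betw_def)
  have cb: "c (b j) = j" "b j \<in> I" if "j < card I" for j
    using bij_betw_inv_into_left[OF b] b that by (auto simp: c_def bij_betw_def)
  let ?A = "product_group {..<card I} (\<lambda>_. G)" and ?B = "product_group I (\<lambda>_. G)"
  define \<phi> where "\<phi> f = (\<lambda>i\<in>I. f (c i))" for f :: "nat \<Rightarrow> 'a"
  have 1: "\<phi> \<in> hom ?A ?B"
    by (rule homI) (auto simp: \<phi>_def c PiE_iff intro!: restrict_ext)
  have "x \<in> \<phi> ` carrier ?A" if x: "x \<in> carrier ?B" for x
  proof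
    show "x = \<phi> (\<lambda>j\<in>{..<card I}. x (b j))"
      using x by (auto simp: \<phi>_def c PiE_iff extensional_def)
    show "(\<lambda>j\<in>{..<card I}. x (b j)) \<in> carrier ?A"
      using x by (auto simp: PiE_iff cb)
  qed
  with subgroup.subset[OF assms(3)] have "S \<subseteq> \<phi> ` carrier ?A" by blast
  from epi_compose_restrict[OF _ _ 1 assms(3) this assms(5)] assms(1,4)
  show ?thesis by (auto simp: pv_generated_def)
qed

lemma pv_generated_finite:
  assumes "group G" "finite (carrier G)" "K \<in> pv_generated G"
  shows "finite (carrier K)"
proof -
  from assms(3) obtain n S h where S: "subgroup S (product_group {..<n::nat} (\<lambda>_. G))"
    and h: "h \<in> epi ((product_group {..<n} (\<lambda>_. G))\<lparr>carrier := S\<rparr>) K"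
    by (auto simp: pv_generated_def)
  have "finite S" using subgroup.subset[OF S] by (rule finite_subset) (simp add: finite_PiE assms(2))
  moreover have "carrier K = h ` S" using h by (simp add: epi_def)
  ultimately show ?thesis by simp
qed

lemma pv_generated_product:
  assumes G: "group G" and F: "\<forall>i<n. F i \<in> pv_generated G" and K: "group K"
    and iso: "product_group {..<n::nat} F \<cong> K"
  shows "K \<in> pv_generated G"
proof -
  from F have "\<forall>i<n. group (F i) \<and> (\<exists>m S h. subgroup S (product_group {..<m::nat} (\<lambda>_. G)) \<and>
        h \<in> epi ((product_group {..<m} (\<lambda>_. G))\<lparr>carrier := S\<rparr>) (F i))"
    by (auto simp: pv_generated_def)
  then obtain m S h where Fg: "\<And>i. i < n \<Longrightarrow> group (F i)"
    and S: "\<And>i. i < n \<Longrightarrow> subgroup (S i) (product_group {..<m i::nat} (\<lambda>_. G))"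
    and h: "\<And>i. i < n \<Longrightarrow> h i \<in> epi ((product_group {..<m i} (\<lambda>_. G))\<lparr>carrier := S i\<rparr>) (F i)"
    by metis
  from iso obtain k where k: "k \<in> iso (product_group {..<n} F) K" by (auto simp: is_iso_def)
  let ?I = "SIGMA i:{..<n}. {..<m i}"
  let ?A = "product_group ?I (\<lambda>_. G)"
  let ?P = "product_group {..<n} (\<lambda>i. product_group {..<m i} (\<lambda>_. G))"
  let ?T = "\<Pi>\<^sub>E i\<in>{..<n}. S i"
  define \<phi> where "\<phi> f = (\<lambda>i\<in>{..<n}. \<lambda>j\<in>{..<m i}. f (i, j))" for f :: "nat \<times> nat \<Rightarrow> 'a"
  have gA: "group ?A" and gP: "group ?P" using G by auto
  have \<phi>: "\<phi> \<in> hom ?A ?P"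
    by (rule homI) (auto simp: \<phi>_def PiE_iff intro!: restrict_ext)
  have T: "subgroup ?T ?P"
    using S G by (subst PiE_subgroup_product_group) auto
  have sub: "?T \<subseteq> \<phi> ` carrier ?A"
  proof
    fix x assume "x \<in> ?T"
    then have x: "x \<in> carrier ?P" using subgroup.subset[OF T] by blast
    show "x \<in> \<phi> ` carrier ?A"
    proof
      show "x = \<phi> (\<lambda>(i, j)\<in>?I. x i j)"
        using x by (fastforce simp: \<phi>_def PiE_iff extensional_def fun_eq_iff)
      show "(\<lambda>(i, j)\<in>?I. x i j) \<in> carrier ?A"
        using x by (fastforce simp: PiE_iff)
    qed
  qed
  define g where "g f = (\<lambda>i\<in>{..<n}. h i (f i))" for f :: "nat \<Rightarrow> nat \<Rightarrow> 'a"
  have hS: "h i ` S i = carrier (F i)" "\<And>x y. x \<in> S i \<Longrightarrow> y \<in> S i \<Longrightarrow>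
      h i (x \<otimes>\<^bsub>product_group {..<m i} (\<lambda>_. G)\<^esub> y) = h i x \<otimes>\<^bsub>F i\<^esub> h i y" if "i < n" for i
    using h[OF that] by (auto simp: epi_def hom_def)
  have "g \<in> hom (?P\<lparr>carrier := ?T\<rparr>) (product_group {..<n} F)"
  proof (rule homI)
    fix x assume "x \<in> carrier (?P\<lparr>carrier := ?T\<rparr>)"
    then show "g x \<in> carrier (product_group {..<n} F)"
      using hS(1) by (auto simp: g_def PiE_iff)
  next
    fix x y assume "x \<in> carrier (?P\<lparr>carrier := ?T\<rparr>)" "y \<in> carrier (?P\<lparr>carrier := ?T\<rparr>)"
    then show "g (x \<otimes>\<^bsub>?P\<lparr>carrier := ?T\<rparr>\<^esub> y) = g x \<otimes>\<^bsub>product_group {..<n} F\<^esub> g y"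
      using hS(2) by (auto simp: g_def PiE_iff intro!: restrict_ext)
  qed
  moreover have "z \<in> g ` ?T" if z: "z \<in> carrier (product_group {..<n} F)" for z
  proof -
    have "z i \<in> h i ` S i" if "i < n" for i using z that by (auto simp: hS(1) PiE_iff)
    then have "\<forall>i<n. \<exists>s\<in>S i. h i s = z i" by (metis imageE)
    then obtain s where s: "\<And>i. i < n \<Longrightarrow> s i \<in> S i \<and> h i (s i) = z i" by metis
    show ?thesis
    proof
      show "z = g (restrict s {..<n})" using z s by (auto simp: g_def PiE_iff extensional_def)
      show "restrict s {..<n} \<in> ?T" using s by auto
    qed
  qed
  ultimately have "g \<in> epi (?P\<lparr>carrier := ?T\<rparr>) (product_group {..<n} F)"
    by (auto simp: epi_iff_subset)
  then have kg: "k \<circ> g \<in> epi (?P\<lparr>carrier := ?T\<rparr>) K"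
    using k by (intro epi_compose) (auto simp: iso_iff_mon_epi)
  from epi_compose_restrict[OF gA gP \<phi> T sub kg] obtain U
    where "subgroup U ?A" "k \<circ> g \<circ> \<phi> \<in> epi (?A\<lparr>carrier := U\<rparr>) K" by blast
  then show ?thesis by (intro pv_generatedI[OF G _ _ K]) auto
qed

lemma pseudovariety_pv_generated:
  assumes G: "group G" "finite (carrier G)"
  shows "pseudovariety (pv_generated G)"
  unfolding pseudovariety_def
proof (intro conjI ballI allI impI; (elim conjE)?)
  fix K assume "K \<in> pv_generated G"
  then show "group K" "finite (carrier K)"
    using pv_generated_finite[OF G] by (auto simp: pv_generated_def)
next
  fix K U assume K: "K \<in> pv_generated G" and U: "subgroup U K"
  from K obtain n S h where gK: "group K" and S: "subgroup S (product_group {..<n::nat} (\<lambda>_. G))"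
    and h: "h \<in> epi ((product_group {..<n} (\<lambda>_. G))\<lparr>carrier := S\<rparr>) K"
    by (auto simp: pv_generated_def)
  let ?P = "product_group {..<n} (\<lambda>_. G)"
  have P: "group ?P" using G by simp
  have PS: "group (?P\<lparr>carrier := S\<rparr>)" by (rule subgroup.subgroup_is_group[OF S P])
  have gU: "group (K\<lparr>carrier := U\<rparr>)" by (rule subgroup.subgroup_is_group[OF U gK])
  have id: "id \<in> epi (K\<lparr>carrier := U\<rparr>) (K\<lparr>carrier := U\<rparr>)"
    by (auto simp: epi_def hom_def subgroup.m_closed[OF U])
  have hh: "h \<in> hom (?P\<lparr>carrier := S\<rparr>) K" "U \<subseteq> h ` carrier (?P\<lparr>carrier := S\<rparr>)"
    using h subgroup.subset[OF U] by (auto simp: epi_def)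
  from epi_compose_restrict[OF PS gK hh(1) U hh(2) id]
  obtain T where T: "subgroup T (?P\<lparr>carrier := S\<rparr>)"
    and hT: "h \<in> epi (?P\<lparr>carrier := T\<rparr>) (K\<lparr>carrier := U\<rparr>)" by auto
  have "subgroup T ?P" using group.incl_subgroup[OF P S T] .
  with hT gU show "K\<lparr>carrier := U\<rparr> \<in> pv_generated G" by (auto simp: pv_generated_def)
next
  fix K L :: "nat monoid" and k assume "K \<in> pv_generated G" "group L" "k \<in> epi K L"
  then show "L \<in> pv_generated G"
    by (auto simp: pv_generated_def intro: epi_compose)
next
  fix n and F :: "nat \<Rightarrow> nat monoid" and K :: "nat monoid"
  assume "\<forall>i<n. F i \<in> pv_generated G" "group K" "product_group {..<n} F \<cong> K"
  then show "K \<in> pv_generated G" by (rule pv_generated_product[OF G(1)])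
qed

lemma pv_generated_contains:
  assumes "group G" "group K" "G \<cong> K"
  shows "K \<in> pv_generated G"
proof -
  let ?P = "product_group {()} (\<lambda>_. G)"
  from assms(3) obtain k where k: "k \<in> iso G K" by (auto simp: is_iso_def)
  have P: "group ?P" using assms by simp
  have "k \<circ> (\<lambda>f. f ()) \<in> epi ?P K"
  proof (rule epi_compose)
    show "(\<lambda>f. f ()) \<in> epi ?P G"
      by (auto simp: epi_iff_subset hom_def PiE_iff image_iff intro!: bexI[of _ "\<lambda>_. _"])
    show "k \<in> epi G K" using k by (simp add: iso_iff_mon_epi)
  qed
  then have ep: "k \<circ> (\<lambda>f. f ()) \<in> epi (?P\<lparr>carrier := carrier ?P\<rparr>) K"
    by (simp add: epi_def hom_def)
  show ?thesis
    by (rule pv_generatedI[OF assms(1) _ group.subgroup_self[OF P] assms(2) ep]) simp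
qed

lemma pv_generated_least:
  assumes V: "pseudovariety V" and K: "K \<in> V" "G \<cong> K" and G: "group G"
  shows "pv_generated G \<subseteq> V"
proof
  fix L assume "L \<in> pv_generated G"
  then obtain n S h where gL: "group L" and S: "subgroup S (product_group {..<n::nat} (\<lambda>_. G))"
    and h: "h \<in> epi ((product_group {..<n} (\<lambda>_. G))\<lparr>carrier := S\<rparr>) L"
    by (auto simp: pv_generated_def)
  have V1: "\<And>G. G \<in> V \<Longrightarrow> group G \<and> finite (carrier G)"
    and V2: "\<And>G S. G \<in> V \<Longrightarrow> subgroup S G \<Longrightarrow> G\<lparr>carrier := S\<rparr> \<in> V"
    and V3: "\<And>G K h. G \<in> V \<Longrightarrow> group K \<Longrightarrow> h \<in> epi G K \<Longrightarrow> K \<in> V"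
    and V4: "\<And>n F K. (\<And>i. i < n \<Longrightarrow> F i \<in> V) \<Longrightarrow> group K \<Longrightarrow>
               product_group {..<n::nat} F \<cong> K \<Longrightarrow> K \<in> V"
    using V unfolding pseudovariety_def by meson+
  let ?P = "product_group {..<n} (\<lambda>_. G)" and ?Q = "product_group {..<n} (\<lambda>_. K)"
  have gK: "group K" and fK: "finite (carrier K)"
    using V1[OF K(1)] by blast+
  have Q: "group ?Q" "finite (carrier ?Q)" using gK fK by (auto intro: finite_PiE)
  from K(2) G obtain k where k: "k \<in> iso K G" using group.iso_sym by (fastforce simp: is_iso_def)
  obtain b :: "(nat \<Rightarrow> nat) \<Rightarrow> nat" where b: "inj_on b (carrier ?Q)"
    using finite_imp_inj_to_nat_seg[OF Q(2)] by blast
  define R where "R = \<lparr>carrier = b ` carrier ?Q,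
     monoid.mult = (\<lambda>x y. b (inv_into (carrier ?Q) b x \<otimes>\<^bsub>?Q\<^esub> inv_into (carrier ?Q) b y)), one = b \<one>\<^bsub>?Q\<^esub>\<rparr>"
  have bR: "b \<in> iso ?Q R"
  proof -
    have "b \<in> hom ?Q R"
    proof (rule homI)
      fix x y assume x: "x \<in> carrier ?Q" "y \<in> carrier ?Q"
      then show "b (x \<otimes>\<^bsub>?Q\<^esub> y) = b x \<otimes>\<^bsub>R\<^esub> b y"
        by (simp only: R_def monoid.simps inv_into_f_f[OF b])
    qed (simp only: R_def partial_object.simps imageI)
    moreover have "bij_betw b (carrier ?Q) (carrier R)"
      unfolding R_def partial_object.simps using b by (rule inj_on_imp_bij_betw)
    ultimately show ?thesis by (simp only: iso_def mem_Collect_eq)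
  qed
  then have "group R"
    using group.iso_imp_img_group[OF Q(1) bR] by (simp add: R_def)
  have "?Q \<cong> R" using bR by (auto simp: is_iso_def)
  from V4[OF K(1) \<open>group R\<close> this] have "R \<in> V" .
  define \<psi> where "\<psi> f = (\<lambda>i\<in>{..<n}. k (f i))" for f :: "nat \<Rightarrow> nat"
  have kk: "k ` carrier K = carrier G" "k \<in> hom K G" using k by (auto simp: iso_def bij_betw_def)
  have "\<psi> \<in> hom ?Q ?P"
    using kk(2) by (auto simp: \<psi>_def hom_def PiE_iff intro!: restrict_ext)
  moreover have "z \<in> \<psi> ` carrier ?Q" if z: "z \<in> carrier ?P" for z
  proof -
    have "z i \<in> k ` carrier K" if "i < n" for i using z that by (auto simp: kk(1) PiE_iff)
    then have "\<forall>i<n. \<exists>s\<in>carrier K. k s = z i" by (metis imageE)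
    then obtain s where s: "\<And>i. i < n \<Longrightarrow> s i \<in> carrier K \<and> k (s i) = z i" by metis
    show ?thesis
    proof
      show "z = \<psi> (restrict s {..<n})" using z s by (auto simp: \<psi>_def PiE_iff extensional_def)
      show "restrict s {..<n} \<in> carrier ?Q" using s by auto
    qed
  qed
  ultimately have "\<psi> \<in> epi ?Q ?P" by (auto simp: epi_iff_subset)
  moreover have "inv_into (carrier ?Q) b \<in> epi R ?Q"
    using group.iso_set_sym[OF Q(1) bR] by (simp add: iso_iff_mon_epi)
  ultimately have ep: "\<psi> \<circ> inv_into (carrier ?Q) b \<in> epi R ?P"
    by (intro epi_compose)
  have "group ?P" using G by simp
  have "\<psi> \<circ> inv_into (carrier ?Q) b \<in> hom R ?P"
    and "S \<subseteq> (\<psi> \<circ> inv_into (carrier ?Q) b) ` carrier R"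
    using ep subgroup.subset[OF S] unfolding epi_def by auto
  from epi_compose_restrict[OF \<open>group R\<close> \<open>group ?P\<close> this(1) S this(2) h]
  obtain T where T: "subgroup T R" "h \<circ> (\<psi> \<circ> inv_into (carrier ?Q) b) \<in> epi (R\<lparr>carrier := T\<rparr>) L"
    by blast
  have "R\<lparr>carrier := T\<rparr> \<in> V" by (rule V2[OF \<open>R \<in> V\<close> T(1)])
  then show "L \<in> V" using gL T(2) by (rule V3)
qed


section \<open>Group presentations\<close>

text \<open>
  A letter \<open>(a, False)\<close> stands for the generator \<open>a\<close> and \<open>(a, True)\<close> for its formal inverse; the
  generators are all the elements of the type \<^typ>\<open>'a\<close>.  A relation \<open>u = v\<close> is a pair of words.
\<close>

type_synonym 'a word = "('a \<times> bool) list"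

inductive pres_eq :: "('a word \<times> 'a word) set \<Rightarrow> 'a word \<Rightarrow> 'a word \<Rightarrow> bool"
  for R :: "('a word \<times> 'a word) set" where
  relation: "(u, v) \<in> R \<Longrightarrow> pres_eq R u v"
| cancel: "pres_eq R [(a, s), (a, \<not> s)] []"
| refl: "pres_eq R u u"
| sym: "pres_eq R u v \<Longrightarrow> pres_eq R v u"
| trans: "pres_eq R u v \<Longrightarrow> pres_eq R v w \<Longrightarrow> pres_eq R u w"
| append: "pres_eq R u u' \<Longrightarrow> pres_eq R v v' \<Longrightarrow> pres_eq R (u @ v) (u' @ v')"

definition presented_group :: "('a word \<times> 'a word) set \<Rightarrow> 'a word set monoid" where
  "presented_group R =
     \<lparr>carrier = UNIV // {(u, v). pres_eq R u v},
      monoid.mult = (\<lambda>A B. {w. \<exists>u\<in>A. \<exists>v\<in>B. pres_eq R (u @ v) w}),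
      one = {w. pres_eq R [] w}\<rparr>"

lemma group_presented_group: "group (presented_group R)"
proof -
  let ?c = "\<lambda>u. {w. pres_eq R u w}"
  have car: "carrier (presented_group R) = range ?c"
    by (auto simp: presented_group_def quotient_def)
  have eq: "?c u = ?c v \<longleftrightarrow> pres_eq R u v" for u v
    by (auto intro: pres_eq.refl pres_eq.sym pres_eq.trans)
  have mult: "?c u \<otimes>\<^bsub>presented_group R\<^esub> ?c v = ?c (u @ v)" for u v
    by (auto simp: presented_group_def intro: pres_eq.trans pres_eq.append pres_eq.refl)
  have one: "\<one>\<^bsub>presented_group R\<^esub> = ?c []" by (simp add: presented_group_def)
  have inv: "pres_eq R (map (\<lambda>(a, s). (a, \<not> s)) (rev u) @ u) []" for u
  proof (induction u)
    case (Cons x u)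
    obtain a s where x: "x = (a, s)" by force
    let ?r = "map (\<lambda>(a, s). (a, \<not> s)) (rev u)"
    have "pres_eq R [(a, \<not> s), (a, s)] []" using pres_eq.cancel[of R a "\<not> s"] by simp
    then have "pres_eq R (?r @ [(a, \<not> s), (a, s)] @ u) (?r @ [] @ u)"
      by (intro pres_eq.append pres_eq.refl)
    with Cons show ?case by (auto simp: x intro: pres_eq.trans)
  qed (auto intro: pres_eq.refl)
  show ?thesis
  proof (rule groupI)
    fix x assume "x \<in> carrier (presented_group R)"
    then obtain u where x: "x = ?c u" by (auto simp: car)
    have "?c (map (\<lambda>(a, s). (a, \<not> s)) (rev u)) \<otimes>\<^bsub>presented_group R\<^esub> x = \<one>\<^bsub>presented_group R\<^esub>"
      unfolding x one mult eq by (rule inv)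
    then show "\<exists>y\<in>carrier (presented_group R). y \<otimes>\<^bsub>presented_group R\<^esub> x = \<one>\<^bsub>presented_group R\<^esub>"
      unfolding car by blast
    show "\<one>\<^bsub>presented_group R\<^esub> \<otimes>\<^bsub>presented_group R\<^esub> x = x"
      by (simp only: x one mult append_Nil)
  next
    fix x y z
    assume "x \<in> carrier (presented_group R)" "y \<in> carrier (presented_group R)" "z \<in> carrier (presented_group R)"
    then show "x \<otimes>\<^bsub>presented_group R\<^esub> y \<otimes>\<^bsub>presented_group R\<^esub> z =
        x \<otimes>\<^bsub>presented_group R\<^esub> (y \<otimes>\<^bsub>presented_group R\<^esub> z)"
      unfolding car by (elim rangeE) (simp only: mult append_assoc)
  next
    fix x y assume "x \<in> carrier (presented_group R)" "y \<in> carrier (presented_group R)"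
    then show "x \<otimes>\<^bsub>presented_group R\<^esub> y \<in> carrier (presented_group R)"
      unfolding car by (elim rangeE) (simp only: mult, blast)
  qed (auto simp: one car)
qed

datatype gens = Gen_x | Gen_y

definition G_pd :: "nat \<Rightarrow> nat \<Rightarrow> nat \<Rightarrow> gens word set monoid" where
  "G_pd p d q =
     (let x = (Gen_x, False); y = (Gen_y, False); y' = (Gen_y, True) in
      presented_group
        {(replicate p x, []),
         (replicate d y, []),
         ([y, x, y'], replicate q x)})"

end

theory Submission
  imports Defs
begin

text \<open>
  Put \<open>V = Ab p \<^bold>* Ab d\<close>. The proof rests on the fact that \<open>V\<close> is defined by three laws
  (\<open>pv_product_Ab_metab_laws\<close>): since \<open>p\<close> and \<open>d\<close> are coprime, the kernel in a group of \<open>V\<close> must be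
  the set \<open>N\<close> of elements killed by \<open>p\<close>, and this set consists of the \<open>d\<close>-th powers. The presented
  group is isomorphic to the group of affine maps \<open>z \<mapsto> q\<^sup>j z + i\<close> of the field with \<open>p\<close> elements
  (\<open>G_pd_iso_affine\<close>), which satisfies the laws; so it generates a part of \<open>V\<close>.

  For the converse it is enough to separate the elements of each group in \<open>V\<close> by homomorphisms
  to the affine group (\<open>pv_generated_residual\<close>). To separate \<open>g\<close> from the identity, divide by a normal
  subgroup maximal without \<open>g\<close>, so that \<open>g\<close> comes to lie in every nontrivial normal subgroup. The
  field with \<open>p\<close> elements contains all \<open>d\<close>-th roots of unity, so every element acts on \<open>N\<close>
  diagonalisably (\<open>eigenspaces_span\<close>). Its eigenspaces are normal subgroups, so only one is
  nontrivial and the action is by scalars. Hence \<open>N\<close> is trivial or cyclic of order \<open>p\<close>. If \<open>N\<close> is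
  cyclic and some \<open>t\<close> does not commute with \<open>g\<close>, the cocycle \<open>k \<mapsto> [k, t]\<close> and the scalar character
  together form the desired homomorphism. Otherwise the group is cyclic, and it embeds in the translations or
  in the rotations.

  For minimality, a group \<open>H\<close> generating \<open>V\<close> satisfies the same laws as the affine group. With \<open>m\<close> the
  index of \<open>N\<close> in \<open>H\<close>, the laws \<open>x ^ (d * card N) = 1\<close> and \<open>x ^ (m * p) = 1\<close> of \<open>H\<close>
  show that \<open>p\<close> divides the order of \<open>N\<close> and \<open>d\<close> divides \<open>m\<close>, so the order of \<open>H\<close> is at
  least \<open>p d\<close>. In case of equality, a law saying that certain powers commute with \<open>d\<close>-th powers
  forces the action of \<open>H\<close> on \<open>N\<close> to have an element acting as \<open>q\<close>, and then the relations of the presentation can be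
  realised in \<open>H\<close> (\<open>iso_affine_of_order\<close>).
\<close>


section \<open>Evaluation of words and group laws\<close>

text \<open>
  The value of a word under an assignment \<open>a\<close> of the generators serves two purposes: it
  describes group laws, and it evaluates presentations.
\<close>

primrec word_eval :: "('a, 'b) monoid_scheme \<Rightarrow> ('g \<Rightarrow> 'a) \<Rightarrow> 'g word \<Rightarrow> 'a" where
  "word_eval G a [] = \<one>\<^bsub>G\<^esub>"
| "word_eval G a (l # w) =
     (if snd l then inv\<^bsub>G\<^esub> (a (fst l)) else a (fst l)) \<otimes>\<^bsub>G\<^esub> word_eval G a w"

definition satisfies :: "('a, 'b) monoid_scheme \<Rightarrow> 'g word \<times> 'g word \<Rightarrow> bool" where
  "satisfies G l \<longleftrightarrow>
     (\<forall>a. range a \<subseteq> carrier G \<longrightarrow> word_eval G a (fst l) = word_eval G a (snd l))"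

context group begin

lemma word_eval_in_subgroup:
  assumes "subgroup S G" "range a \<subseteq> S"
  shows "word_eval G a w \<in> S"
proof (induction w)
  case (Cons l w)
  have "a (fst l) \<in> S" using assms(2) by blast
  with Cons assms(1) show ?case by (auto simp: subgroup.m_closed subgroup.m_inv_closed)
qed (simp add: subgroup.one_closed assms)

lemma word_eval_closed [simp]:
  "range a \<subseteq> carrier G \<Longrightarrow> word_eval G a w \<in> carrier G"
  by (rule word_eval_in_subgroup[OF subgroup_self])

lemma word_eval_append:
  assumes "range a \<subseteq> carrier G"
  shows "word_eval G a (u @ v) = word_eval G a u \<otimes> word_eval G a v"
proof (induction u)
  case (Cons l u)
  have "a (fst l) \<in> carrier G" using assms by blast
  with Cons assms show ?case by (simp add: m_assoc)
qed (use assms in simp)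

lemma word_eval_replicate:
  assumes "range a \<subseteq> carrier G"
  shows "word_eval G a (replicate n (g, False)) = a g [^] n"
proof -
  have "a g \<in> carrier G" using assms by blast
  then show ?thesis by (induction n) (auto simp: nat_pow_Suc2[symmetric] simp del: nat_pow_Suc)
qed

lemma word_eval_concat_replicate:
  assumes "range a \<subseteq> carrier G"
  shows "word_eval G a (concat (replicate n w)) = word_eval G a w [^] n"
  using assms
  by (induction n) (auto simp: nat_pow_Suc2[symmetric] word_eval_append simp del: nat_pow_Suc)

end

lemma word_eval_hom:
  assumes "group G" "group H" "h \<in> hom G H" "range a \<subseteq> carrier G"
  shows "h (word_eval G a w) = word_eval H (h \<circ> a) w"
proof -
  interpret group_hom G H h using assms by (simp add: group_hom_def group_hom_axioms_def)
  have "a g \<in> carrier G" for g using assms(4) by blast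
  then show ?thesis using assms(4) by (induction w) auto
qed

lemma satisfies_inj_hom:
  fixes l :: "'g word \<times> 'g word"
  assumes "group G" "group H" "h \<in> hom G H" "inj_on h (carrier G)" "satisfies H l"
  shows "satisfies G l"
  unfolding satisfies_def
proof (intro allI impI)
  fix a :: "'g \<Rightarrow> _" assume a: "range a \<subseteq> carrier G"
  have "range (h \<circ> a) \<subseteq> carrier H" using a assms(3) by (auto simp: hom_def)
  with assms(5) have "h (word_eval G a (fst l)) = h (word_eval G a (snd l))"
    by (simp add: satisfies_def word_eval_hom[OF assms(1-3) a])
  with a assms(1,4) show "word_eval G a (fst l) = word_eval G a (snd l)"
    by (simp add: inj_on_eq_iff group.word_eval_closed)
qed

lemma satisfies_epi:
  fixes l :: "'g word \<times> 'g word"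
  assumes "group G" "group H" "h \<in> epi G H" "satisfies G l"
  shows "satisfies H l"
  unfolding satisfies_def
proof (intro allI impI)
  fix a :: "'g \<Rightarrow> _" assume a: "range a \<subseteq> carrier H"
  have h: "h \<in> hom G H" "h ` carrier G = carrier H" using assms(3) by (auto simp: epi_def)
  then have "\<forall>g. \<exists>x\<in>carrier G. h x = a g" using a by (metis imageE rangeI subsetD)
  then obtain b where b: "\<And>g. b g \<in> carrier G" "\<And>g. h (b g) = a g" by metis
  then have r: "range b \<subseteq> carrier G" and "h \<circ> b = a" by auto
  with assms(4) show "word_eval H a (fst l) = word_eval H a (snd l)"
    using word_eval_hom[OF assms(1,2) h(1) r] by (metis satisfies_def)
qed

lemma satisfies_product_group:
  fixes l :: "'g word \<times> 'g word"
  assumes "\<And>i. i \<in> I \<Longrightarrow> group (G i)" "\<And>i. i \<in> I \<Longrightarrow> satisfies (G i) l"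
  shows "satisfies (product_group I G) l"
  unfolding satisfies_def
proof (intro allI impI)
  let ?P = "product_group I G"
  fix a :: "'g \<Rightarrow> _" assume a: "range a \<subseteq> carrier ?P"
  have P: "group ?P" using assms(1) by simp
  have cl: "word_eval ?P a w \<in> carrier ?P" for w using group.word_eval_closed[OF P a] .
  have "word_eval ?P a (fst l) i = word_eval ?P a (snd l) i" if i: "i \<in> I" for i
  proof -
    have h: "(\<lambda>f. f i) \<in> hom ?P (G i)" using i by (auto simp: hom_def)
    have "range ((\<lambda>f. f i) \<circ> a) \<subseteq> carrier (G i)" using a i by (auto simp: PiE_iff)
    then show ?thesis
      using word_eval_hom[OF P assms(1)[OF i] h a] assms(2)[OF i] by (simp add: satisfies_def)
  qed
  with cl show "word_eval ?P a (fst l) = word_eval ?P a (snd l)"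
    by (intro extensionalityI[of _ I]) (auto simp: PiE_iff)
qed

text \<open>
  Laws are inherited by subgroups, products and images (the easy half of Birkhoff's theorem),
  hence by the whole pseudovariety generated by a group. The lower bound on the order of
  generators comes from here: a law of a generator is a law of all members of the pseudovariety.
\<close>

lemma satisfies_pv_generated:
  fixes l :: "'g word \<times> 'g word"
  assumes "group G" "satisfies G l" "K \<in> pv_generated G"
  shows "satisfies K l"
proof -
  let ?P = "\<lambda>n::nat. product_group {..<n} (\<lambda>_. G)"
  from assms(3) obtain n S h where K: "group K" and S: "subgroup S (?P n)"
    and h: "h \<in> epi ((?P n)\<lparr>carrier := S\<rparr>) K" by (auto simp: pv_generated_def)
  have P: "group (?P n)" "satisfies (?P n) l" using assms by (auto intro: satisfies_product_group)
  have gS: "group ((?P n)\<lparr>carrier := S\<rparr>)" by (rule subgroup.subgroup_is_group[OF S P(1)])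
  have "id \<in> hom ((?P n)\<lparr>carrier := S\<rparr>) (?P n)" using subgroup.subset[OF S] by (auto simp: hom_def simp del: carrier_product_group)
  from satisfies_inj_hom[OF gS P(1) this _ P(2)] have "satisfies ((?P n)\<lparr>carrier := S\<rparr>) l" by simp
  from satisfies_epi[OF gS K h this] show ?thesis .
qed

lemma satisfies_gens_iff:
  "satisfies G (u, v) \<longleftrightarrow> (\<forall>x\<in>carrier G. \<forall>y\<in>carrier G.
     word_eval G (case_gens x y) u = word_eval G (case_gens x y) v)"
proof -
  have "a = case_gens (a Gen_x) (a Gen_y)" for a :: "gens \<Rightarrow> 'a"
    by (rule ext) (simp split: gens.split)
  moreover have "range (case_gens x y) \<subseteq> carrier G \<longleftrightarrow> x \<in> carrier G \<and> y \<in> carrier G" for x y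
    by (force simp: image_iff split: gens.splits)
  ultimately show ?thesis unfolding satisfies_def by (metis fst_conv snd_conv)
qed

definition power_law :: "nat \<Rightarrow> gens word \<times> gens word" where
  "power_law k = (replicate k (Gen_x, False), [])"

definition powers_commute_law :: "nat \<Rightarrow> nat \<Rightarrow> gens word \<times> gens word" where
  "powers_commute_law k m =
     (replicate k (Gen_x, False) @ replicate m (Gen_y, False),
      replicate m (Gen_y, False) @ replicate k (Gen_x, False))"

definition commutator_power_law :: "nat \<Rightarrow> gens word \<times> gens word" where
  "commutator_power_law k =
     (concat (replicate k [(Gen_x, False), (Gen_y, False), (Gen_x, True), (Gen_y, True)]), [])"

context group begin

lemma range_case_gens: "x \<in> carrier G \<Longrightarrow> y \<in> carrier G \<Longrightarrow> range (case_gens x y) \<subseteq> carrier G"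
  by (auto split: gens.splits)

lemma satisfies_power_law: "satisfies G (power_law k) \<longleftrightarrow> (\<forall>x\<in>carrier G. x [^] k = \<one>)"
  unfolding power_law_def satisfies_gens_iff
  by (auto simp: range_case_gens word_eval_replicate)

lemma satisfies_powers_commute_law:
  "satisfies G (powers_commute_law k m) \<longleftrightarrow>
     (\<forall>x\<in>carrier G. \<forall>y\<in>carrier G. x [^] k \<otimes> y [^] m = y [^] m \<otimes> x [^] k)"
  unfolding powers_commute_law_def satisfies_gens_iff
  by (auto simp: range_case_gens word_eval_replicate word_eval_append)

lemma satisfies_commutator_power_law:
  "satisfies G (commutator_power_law k) \<longleftrightarrow>
     (\<forall>x\<in>carrier G. \<forall>y\<in>carrier G. (x \<otimes> y \<otimes> inv x \<otimes> inv y) [^] k = \<one>)"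
  unfolding commutator_power_law_def satisfies_gens_iff
  by (auto simp: range_case_gens word_eval_concat_replicate m_assoc)

end


section \<open>Powers, conjugation and cosets\<close>

lemma (in group) pow_mod:
  assumes "x \<in> carrier G" "x [^] (n::nat) = \<one>"
  shows "x [^] (m mod n) = x [^] m"
proof -
  have "x [^] m = x [^] (n * (m div n) + m mod n)" by simp
  also have "\<dots> = (x [^] n) [^] (m div n) \<otimes> x [^] (m mod n)"
    using assms(1) by (simp add: nat_pow_pow nat_pow_mult del: mult_div_mod_eq)
  finally show ?thesis using assms by simp
qed

lemma (in group) pow_cong:
  assumes "x \<in> carrier G" "x [^] (n::nat) = \<one>" "[i = j] (mod n)"
  shows "x [^] i = x [^] j"
  using pow_mod[OF assms(1,2)] assms(3) by (metis cong_def)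

lemma (in group) coprime_pow_eq_one:
  assumes "x \<in> carrier G" "x [^] (m::nat) = \<one>" "x [^] (n::nat) = \<one>" "coprime m n"
  shows "x = \<one>"
proof -
  have "group.ord G x dvd 1" using assms by (metis pow_eq_id coprime_def)
  then show ?thesis using ord_eq_1[OF assms(1)] by simp
qed

lemma (in group) nat_pow_eq_iff:
  "x \<in> carrier G \<Longrightarrow> x [^] (i::nat) = x [^] (j::nat) \<longleftrightarrow> [i = j] (mod group.ord G x)"
  using int_pow_eq[of x "int i" "int j"]
  unfolding int_pow_int cong_int_iff[symmetric] cong_iff_dvd_diff
  by (metis dvd_diff_commute)

lemma (in group) prime_pow_eq_iff:
  assumes "x \<in> carrier G" "x \<noteq> \<one>" "x [^] p = \<one>" "prime (p::nat)"
  shows "x [^] i = x [^] j \<longleftrightarrow> [i = j] (mod p)"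
proof -
  have *: "group.ord G x dvd p" using assms by (simp add: pow_eq_id)
  have "group.ord G x \<noteq> 1" using assms(2) ord_eq_1[OF assms(1)] by simp
  with * assms(4) have o: "group.ord G x = p" by (metis prime_nat_iff)
  show ?thesis using nat_pow_eq_iff[OF assms(1)] o by simp
qed

lemma (in group) mem_generate_iff:
  assumes "finite (carrier G)" "x \<in> carrier G"
  shows "y \<in> generate G {x} \<longleftrightarrow> (\<exists>j::nat. y = x [^] j)"
proof -
  have "group.ord G x \<noteq> 0" using ord_ge_1[OF assms] by simp
  then show ?thesis using generate_pow_nat[OF assms(2)] by auto
qed

lemma (in group) conj_pow:
  assumes "k \<in> carrier G" "x \<in> carrier G"
  shows "(k \<otimes> x \<otimes> inv k) [^] (n::nat) = k \<otimes> x [^] n \<otimes> inv k"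
proof (induction n)
  case (Suc n)
  have "inv k \<otimes> (k \<otimes> z) = z" if "z \<in> carrier G" for z
    using assms that by (simp flip: m_assoc)
  then show ?case using Suc assms by (simp add: m_assoc)
qed (use assms in simp)

lemma (in group) conj_mult:
  assumes "k \<in> carrier G" "x \<in> carrier G" "y \<in> carrier G"
  shows "k \<otimes> (x \<otimes> y) \<otimes> inv k = (k \<otimes> x \<otimes> inv k) \<otimes> (k \<otimes> y \<otimes> inv k)"
proof -
  have "inv k \<otimes> (k \<otimes> z) = z" if "z \<in> carrier G" for z
    using assms that by (simp flip: m_assoc)
  then show ?thesis using assms by (simp add: m_assoc)
qed

lemma (in group) conj_conj:
  assumes "k \<in> carrier G" "h \<in> carrier G" "x \<in> carrier G"
  shows "k \<otimes> (h \<otimes> x \<otimes> inv h) \<otimes> inv k = (k \<otimes> h) \<otimes> x \<otimes> inv (k \<otimes> h)"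
  using assms by (simp add: m_assoc inv_mult_group)

lemma (in group) conj_iterate:
  assumes "k \<in> carrier G" "x \<in> carrier G" "k \<otimes> x \<otimes> inv k = x [^] (u::nat)"
  shows "k [^] (m::nat) \<otimes> x \<otimes> inv (k [^] m) = x [^] (u ^ m)"
proof (induction m)
  case (Suc m)
  have "k [^] Suc m \<otimes> x \<otimes> inv (k [^] Suc m) = k [^] m \<otimes> (k \<otimes> x \<otimes> inv k) \<otimes> inv (k [^] m)"
    using conj_conj[OF nat_pow_closed[OF assms(1)] assms(1,2), of m] by simp
  also have "\<dots> = (k [^] m \<otimes> x \<otimes> inv (k [^] m)) [^] u"
    unfolding assms(3) by (rule conj_pow[symmetric]) (use assms in simp_all)
  also have "\<dots> = x [^] (u ^ Suc m)" unfolding Suc using assms by (simp add: nat_pow_pow mult.commute)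
  finally show ?case .
qed (use assms in simp)

lemma (in group) conj_eq_iff_commute:
  assumes "k \<in> carrier G" "x \<in> carrier G"
  shows "k \<otimes> x \<otimes> inv k = x \<longleftrightarrow> k \<otimes> x = x \<otimes> k"
  using assms by (simp add: inv_solve_right')

lemma (in group) commutator_eq_one_iff:
  assumes "a \<in> carrier G" "b \<in> carrier G"
  shows "a \<otimes> b \<otimes> inv a \<otimes> inv b = \<one> \<longleftrightarrow> a \<otimes> b = b \<otimes> a"
proof -
  have "a \<otimes> b \<otimes> inv a \<otimes> inv b = (a \<otimes> b) \<otimes> inv (b \<otimes> a)"
    using assms by (simp add: inv_mult_group m_assoc)
  then show ?thesis using assms inv_solve_right'[of \<one> "a \<otimes> b" "b \<otimes> a"] by simp
qed

lemma (in group) rcos_eq_self_iff: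
  "subgroup H G \<Longrightarrow> x \<in> carrier G \<Longrightarrow> H #> x = H \<longleftrightarrow> x \<in> H"
  by (metis coset_join1 coset_join2 subgroup.subset)


section \<open>The affine group and the presentation\<close>

locale affine_params =
  fixes p d q :: nat
  assumes prime_p: "prime p" and ord_q: "ord p q = d" and d_gt_1: "d > 1"

context affine_params begin

lemma p_gt_1: "p > 1" using prime_p by (rule prime_gt_1_nat)

lemma coprime_p_q: "coprime p q"
  using ord_q d_gt_1 by (metis ord_eq_0 not_one_less_zero)

lemma pow_q_cong_iff: "[q ^ i = q ^ j] (mod p) \<longleftrightarrow> [i = j] (mod d)"
  using order_divides_expdiff[OF coprime_p_q] ord_q by simp

lemma d_dvd: "d dvd p - 1"
  using order_divides_totient[OF coprime_p_q] ord_q totient_prime[OF prime_p] by simp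

lemma p_cong_1: "[p = 1] (mod d)"
  using d_dvd p_gt_1 by (metis cong_altdef_nat less_imp_le_nat)

lemma d_less_p: "d < p"
  using d_dvd p_gt_1 by (metis dvd_imp_le diff_less less_le_trans not_le zero_less_diff zero_less_one
    le_less_trans less_trans)

lemma coprime_p_d: "coprime p d"
  using d_less_p d_gt_1 prime_p by (metis prime_imp_coprime nat_dvd_not_less not_one_less_zero neq0_conv)

text \<open>
  Multiplication by \<open>q\<^sup>j - 1\<close>, which is invertible modulo \<open>p\<close>, makes the sum telescope to
  \<open>q\<^sup>j\<close> to the power \<open>d\<close> minus \<open>1\<close>, and this vanishes modulo \<open>p\<close>.
\<close>

lemma (in affine_params) dvd_geometric_sum:
  assumes "0 < j" "j < d"
  shows "p dvd (\<Sum>i<d. q ^ (i * j))"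
proof -
  let ?x = "int (q ^ j)"
  have "[q ^ (j * d) = q ^ 0] (mod p)" unfolding pow_q_cong_iff by (simp add: cong_def)
  then have "[int (q ^ (j * d)) = int (q ^ 0)] (mod int p)" by (simp only: cong_int_iff)
  then have "int p dvd ?x ^ d - 1" by (simp add: cong_iff_dvd_diff power_mult)
  then have "int p dvd (?x - 1) * (\<Sum>i<d. ?x ^ i)" by (simp add: power_diff_1_eq)
  moreover have "\<not> int p dvd ?x - 1"
  proof
    assume "int p dvd ?x - 1"
    then have "[int (q ^ j) = int (q ^ 0)] (mod int p)" by (simp add: cong_iff_dvd_diff)
    then have "[q ^ j = q ^ 0] (mod p)" by (simp only: cong_int_iff)
    then have "[j = 0] (mod d)" by (simp only: pow_q_cong_iff)
    with assms show False by (simp add: cong_def)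
  qed
  ultimately have "int p dvd (\<Sum>i<d. ?x ^ i)"
    using prime_p by (metis prime_dvd_mult_iff prime_nat_int_transfer)
  also have "(\<Sum>i<d. ?x ^ i) = int (\<Sum>i<d. q ^ (i * j))"
    by (simp add: power_mult mult.commute[of _ j])
  finally show ?thesis by (simp only: int_dvd_int_iff)
qed

text \<open>
  The pair \<open>(i, j)\<close> stands for the affine map \<open>z \<mapsto> q\<^sup>j z + i\<close> of the field with \<open>p\<close> elements.
  Working with this model rather than with the presentation makes the order and all
  calculations explicit.
\<close>

definition affine_group :: "(nat \<times> nat) monoid" where
  "affine_group = \<lparr>carrier = {..<p} \<times> {..<d},
     monoid.mult = (\<lambda>(i, j) (k, l). ((i + q ^ j * k) mod p, (j + l) mod d)), one = (0, 0)\<rparr>"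

lemma affine_simps [simp]:
  "carrier affine_group = {..<p} \<times> {..<d}"
  "(i, j) \<otimes>\<^bsub>affine_group\<^esub> (k, l) = ((i + q ^ j * k) mod p, (j + l) mod d)"
  "\<one>\<^bsub>affine_group\<^esub> = (0, 0)"
  by (simp_all add: affine_group_def)

lemma affine_cong:
  "[i = i'] (mod p) \<Longrightarrow> [j = j'] (mod d) \<Longrightarrow> [k = k'] (mod p) \<Longrightarrow>
     (i + q ^ j * k) mod p = (i' + q ^ j' * k') mod p"
  by (simp add: cong_add cong_mult pow_q_cong_iff flip: cong_def)

lemma group_affine: "group affine_group"
proof (rule groupI)
  show "\<one>\<^bsub>affine_group\<^esub> \<in> carrier affine_group" using p_gt_1 d_gt_1 by auto
next
  fix x y assume "x \<in> carrier affine_group" "y \<in> carrier affine_group"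
  then show "x \<otimes>\<^bsub>affine_group\<^esub> y \<in> carrier affine_group" using p_gt_1 d_gt_1
    by (cases x; cases y) auto
next
  fix x y z :: "nat \<times> nat"
  obtain i j k l m n where xyz: "x = (i, j)" "y = (k, l)" "z = (m, n)" by (cases x; cases y; cases z)
  have "((i + q ^ j * k) mod p + q ^ ((j + l) mod d) * m) mod p = ((i + q ^ j * k) + q ^ (j + l) * m) mod p"
    by (rule affine_cong) (auto simp: cong_def)
  also have "\<dots> = (i + q ^ j * (k + q ^ l * m)) mod p" by (simp add: algebra_simps power_add)
  also have "\<dots> = (i + q ^ j * ((k + q ^ l * m) mod p)) mod p"
    by (rule affine_cong) (auto simp: cong_def)
  finally show "x \<otimes>\<^bsub>affine_group\<^esub> y \<otimes>\<^bsub>affine_group\<^esub> z = x \<otimes>\<^bsub>affine_group\<^esub> (y \<otimes>\<^bsub>affine_group\<^esub> z)"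
    by (simp add: xyz mod_simps add.assoc)
next
  fix x assume "x \<in> carrier affine_group"
  then obtain i j where x: "x = (i, j)" "i < p" "j < d" by auto
  \<comment> \<open>The inverse is \<open>(- q\<^sup>b i, b)\<close> with \<open>b = - j\<close>; the factor \<open>p - 1\<close> stands for \<open>- 1\<close>.\<close>
  let ?b = "(d - j) mod d" and ?a = "(p - 1) * (q ^ ((d - j) mod d) * i) mod p"
  have "((p - 1) * (q ^ ?b * i) mod p + q ^ ?b * i) mod p = ((p - 1) * (q ^ ?b * i) + q ^ ?b * i) mod p"
    by (simp add: mod_simps)
  also have "(p - 1) * (q ^ ?b * i) + q ^ ?b * i = p * (q ^ ?b * i)"
    using p_gt_1 by (cases p) (auto simp: algebra_simps)
  finally have "(?a, ?b) \<otimes>\<^bsub>affine_group\<^esub> x = \<one>\<^bsub>affine_group\<^esub>"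
    using x by (simp add: mod_simps)
  moreover have "(?a, ?b) \<in> carrier affine_group" using p_gt_1 d_gt_1 by simp
  ultimately show "\<exists>y\<in>carrier affine_group. y \<otimes>\<^bsub>affine_group\<^esub> x = \<one>\<^bsub>affine_group\<^esub>" by blast
qed (use p_gt_1 d_gt_1 in auto)

lemma order_affine: "order affine_group = p * d"
  by (simp add: order_def)

lemma snd_affine_pow:
  "x \<in> carrier affine_group \<Longrightarrow> snd (x [^]\<^bsub>affine_group\<^esub> n) = (n * snd x) mod d"
proof (induction n)
  case (Suc n)
  obtain a b where ab: "x [^]\<^bsub>affine_group\<^esub> n = (a, b)" by force
  with Suc show ?case by (cases x) (simp add: mod_simps add.commute)
qed simp

lemma affine_translation_pow: "(i, 0) [^]\<^bsub>affine_group\<^esub> n = ((n * i) mod p, 0)"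
  by (induction n) (auto simp: mod_simps add.commute)

lemma affine_rotation_pow: "(0, j) [^]\<^bsub>affine_group\<^esub> n = (0, (n * j) mod d)"
  by (induction n) (auto simp: mod_simps add.commute)

lemma affine_rotation_inv: "inv\<^bsub>affine_group\<^esub> (0, 1) = (0, d - 1)"
  by (rule group.inv_equality[OF group_affine]) (use d_gt_1 p_gt_1 in auto)

text \<open>
  Any realisation of the relations of the presentation in which \<open>x\<close> is not trivial contains a copy of the affine
  group. The kernel is trivial: if \<open>x\<^sup>i y\<^sup>j = 1\<close> then \<open>y\<^sup>j\<close> commutes with \<open>x\<close>, so \<open>q\<^sup>j = 1\<close> modulo
  \<open>p\<close> and \<open>d\<close> divides \<open>j\<close>; then \<open>p\<close> divides \<open>i\<close>.
\<close>

lemma affine_embedding: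
  fixes G (structure)
  assumes G: "group G" and x: "x \<in> carrier G" and y: "y \<in> carrier G"
    and rels: "x [^]\<^bsub>G\<^esub> p = \<one>\<^bsub>G\<^esub>" "y [^]\<^bsub>G\<^esub> d = \<one>\<^bsub>G\<^esub>"
      "y \<otimes>\<^bsub>G\<^esub> x \<otimes>\<^bsub>G\<^esub> inv\<^bsub>G\<^esub> y = x [^]\<^bsub>G\<^esub> q"
    and nontrivial: "x \<noteq> \<one>\<^bsub>G\<^esub>"
  defines "f \<equiv> \<lambda>(i, j). x [^]\<^bsub>G\<^esub> i \<otimes>\<^bsub>G\<^esub> y [^]\<^bsub>G\<^esub> j"
  shows "f \<in> hom affine_group G" "inj_on f (carrier affine_group)"
proof -
  interpret group G by (rule G)
  have 1: "y \<otimes> x [^] i = x [^] (q * i) \<otimes> y" for i :: nat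
  proof (induction i)
    case (Suc i)
    have yx: "y \<otimes> x = x [^] q \<otimes> y" using rels(3) x y by (metis inv_solve_right' m_closed nat_pow_closed)
    have "y \<otimes> x [^] Suc i = x [^] (q * i) \<otimes> (y \<otimes> x)" using Suc x y by (simp flip: m_assoc)
    also have "\<dots> = x [^] (q * Suc i) \<otimes> y"
      using x y by (simp add: yx nat_pow_mult add.commute flip: m_assoc)
    finally show ?case .
  qed (use y in simp)
  have 2: "y [^] j \<otimes> x [^] i = x [^] (q ^ j * i) \<otimes> y [^] j" for i j :: nat
  proof (induction j arbitrary: i)
    case (Suc j)
    have "y [^] Suc j \<otimes> x [^] i = y [^] j \<otimes> (y \<otimes> x [^] i)" using x y by (simp add: m_assoc)
    also have "\<dots> = (y [^] j \<otimes> x [^] (q * i)) \<otimes> y" using x y by (simp add: 1 m_assoc)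
    also have "\<dots> = x [^] (q ^ Suc j * i) \<otimes> y [^] Suc j"
      using x y by (simp add: Suc m_assoc mult.assoc mult.left_commute)
    finally show ?case .
  qed (use x in simp)
  show f: "f \<in> hom affine_group G"
  proof (rule homI)
    fix s t :: "nat \<times> nat"
    obtain i j k l where st: "s = (i, j)" "t = (k, l)" by (cases s; cases t)
    have "f (s \<otimes>\<^bsub>affine_group\<^esub> t) = x [^] (i + q ^ j * k) \<otimes> y [^] (j + l)"
      using x y by (simp add: f_def st pow_mod rels)
    also have "\<dots> = x [^] i \<otimes> (x [^] (q ^ j * k) \<otimes> y [^] j) \<otimes> y [^] l"
      using x y by (simp add: m_assoc flip: nat_pow_mult)
    also have "\<dots> = f s \<otimes> f t"
      using x y by (simp add: f_def st m_assoc flip: 2)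
    finally show "f (s \<otimes>\<^bsub>affine_group\<^esub> t) = f s \<otimes> f t" .
  qed (use x y in \<open>auto simp: f_def\<close>)
  interpret f: group_hom affine_group G f
    using f group_affine by (simp add: group_hom_def group_hom_axioms_def G)
  show "inj_on f (carrier affine_group)"
  proof (subst f.inj_on_one_iff, intro allI impI)
    fix s assume "s \<in> carrier affine_group" and fs: "f s = \<one>"
    then obtain i j where s: "s = (i, j)" "i < p" "j < d" by auto
    have xy: "x [^] i \<otimes> y [^] j = \<one>" using fs by (simp add: f_def s)
    have comm: "y [^] j \<otimes> x = x \<otimes> y [^] j"
    proof -
      have "x [^] i \<otimes> (y [^] j \<otimes> x) = x [^] i \<otimes> (x \<otimes> y [^] j)"
        using x y xy
        by (metis l_one m_assoc m_closed nat_pow_closed nat_pow_comm nat_pow_eone r_one)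
      then show ?thesis using x y by simp
    qed
    have "x [^] (q ^ j) \<otimes> y [^] j = y [^] j \<otimes> x" using 2[of j 1] x by simp
    also have "\<dots> = x \<otimes> y [^] j"
      by (rule comm)
    finally have "x [^] (q ^ j) = x [^] (q ^ 0)" using x y by simp
    then have "[q ^ j = q ^ 0] (mod p)"
      using prime_pow_eq_iff[OF x nontrivial rels(1) prime_p] by blast
    then have "[j = 0] (mod d)" by (simp only: pow_q_cong_iff)
    then have j: "j = 0" using s(3) by (simp add: cong_def)
    then have "x [^] i = x [^] (0::nat)" using xy j x by simp
    then have "[i = 0] (mod p)" using prime_pow_eq_iff[OF x nontrivial rels(1) prime_p] by blast
    with s(2) have "i = 0" by (simp add: cong_def)
    with j s(1) show "s = \<one>\<^bsub>affine_group\<^esub>" by simp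
  qed
qed

end

text \<open>
  Equality in a presented group forces equality in every group in which the relations hold;
  this is used to show that a generator of a presented group is not trivial.
\<close>

lemma pres_eq_word_eval:
  assumes "group G" "range a \<subseteq> carrier G"
    and "\<And>u v. (u, v) \<in> R \<Longrightarrow> word_eval G a u = word_eval G a v"
    and "pres_eq R u v"
  shows "word_eval G a u = word_eval G a v"
proof -
  interpret group G by fact
  have a: "a g \<in> carrier G" for g using assms(2) by blast
  from assms(4) show ?thesis
    by (induction rule: pres_eq.induct) (auto simp: word_eval_append assms(2,3) a)
qed

text \<open>
  This allows calculations in a presented group to be made with values of words instead of
  classes of words.
\<close>

lemma presented_group_class:
  fixes R :: "('g word \<times> 'g word) set"
  defines "P \<equiv> presented_group R" and "a \<equiv> \<lambda>g. {v. pres_eq R [(g, False)] v}"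
  shows "range a \<subseteq> carrier P"
    and "word_eval P a w = {v. pres_eq R w v}"
    and "carrier P = range (word_eval P a)"
proof -
  interpret group P unfolding P_def by (rule group_presented_group)
  let ?c = "\<lambda>u. {v. pres_eq R u v}"
  have car: "carrier P = range ?c" by (auto simp: P_def presented_group_def quotient_def)
  have mult: "?c u \<otimes>\<^bsub>P\<^esub> ?c v = ?c (u @ v)" for u v
    by (auto simp: P_def presented_group_def intro: pres_eq.trans pres_eq.append pres_eq.refl)
  have one: "\<one>\<^bsub>P\<^esub> = ?c []" by (simp add: P_def presented_group_def)
  have a: "a g \<in> carrier P" for g by (auto simp: car a_def)
  then show "range a \<subseteq> carrier P" by auto
  have "?c [(g, True)] \<otimes>\<^bsub>P\<^esub> a g = \<one>\<^bsub>P\<^esub>" for g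
    using pres_eq.cancel[of R g True]
    by (auto simp: a_def mult one intro: pres_eq.trans pres_eq.sym)
  then have inv: "inv\<^bsub>P\<^esub> a g = ?c [(g, True)]" for g
    using a by (intro inv_equality) (auto simp: car)
  show ev: "word_eval P a w = ?c w" for w
  proof (induction w)
    case (Cons l w)
    have "(if snd l then inv\<^bsub>P\<^esub> (a (fst l)) else a (fst l)) = ?c [l]"
      using inv by (cases l) (auto simp: a_def)
    then show ?case by (simp add: Cons mult del: mult_FactGroup)
  qed (simp add: one)
  show "carrier P = range (word_eval P a)" by (simp add: car ev)
qed

text \<open>
  The generator \<open>x\<close> of the presented group is not trivial because it is not trivial in the
  affine group, where the relations hold. So \<open>affine_embedding\<close> applies, and the image
  contains both generators.
\<close>

lemma (in affine_params) G_pd_iso_affine: "group (G_pd p d q)" "affine_group \<cong> G_pd p d q"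
proof -
  define R :: "(gens word \<times> gens word) set" where "R =
     {(replicate p (Gen_x, False), []), (replicate d (Gen_y, False), []),
      ([(Gen_y, False), (Gen_x, False), (Gen_y, True)], replicate q (Gen_x, False))}"
  define P where "P = presented_group R"
  have GP: "G_pd p d q = P" by (simp add: G_pd_def Let_def P_def R_def)
  show gr: "group (G_pd p d q)" unfolding GP P_def by (rule group_presented_group)
  then interpret P: group P by (simp add: GP)
  define a where "a = (\<lambda>g. {v. pres_eq R [(g, False)] v})"
  note cls = presented_group_class[of R, folded P_def a_def]
  have a: "a g \<in> carrier P" for g using cls(1) by blast
  have rel: "word_eval P a u = word_eval P a v" if "(u, v) \<in> R" for u v
  proof -
    note uv = pres_eq.relation[OF that]
    have "pres_eq R u w \<longleftrightarrow> pres_eq R v w" for w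
      using pres_eq.trans[OF uv] pres_eq.trans[OF pres_eq.sym[OF uv]] by metis
    then have "pres_eq R u = pres_eq R v" by (rule ext)
    then show ?thesis unfolding cls(2) by (simp only:)
  qed
  have x: "a Gen_x [^]\<^bsub>P\<^esub> p = \<one>\<^bsub>P\<^esub>"
    using rel[of "replicate p (Gen_x, False)" "[]"] by (simp add: R_def P.word_eval_replicate[OF cls(1)])
  have y: "a Gen_y [^]\<^bsub>P\<^esub> d = \<one>\<^bsub>P\<^esub>"
    using rel[of "replicate d (Gen_y, False)" "[]"] by (simp add: R_def P.word_eval_replicate[OF cls(1)])
  have xy: "a Gen_y \<otimes>\<^bsub>P\<^esub> a Gen_x \<otimes>\<^bsub>P\<^esub> inv\<^bsub>P\<^esub> a Gen_y = a Gen_x [^]\<^bsub>P\<^esub> q"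
    using rel[of "[(Gen_y, False), (Gen_x, False), (Gen_y, True)]" "replicate q (Gen_x, False)"] a
    by (simp add: R_def P.word_eval_replicate[OF cls(1)] P.m_assoc)
  have nontrivial: "a Gen_x \<noteq> \<one>\<^bsub>P\<^esub>"
  proof
    interpret A: group affine_group by (rule group_affine)
    define b :: "gens \<Rightarrow> nat \<times> nat" where "b = case_gens (1, 0) (0, 1)"
    have b: "range b \<subseteq> carrier affine_group"
      unfolding b_def by (rule A.range_case_gens) (use p_gt_1 d_gt_1 in auto)
    have R: "word_eval affine_group b u = word_eval affine_group b v" if "(u, v) \<in> R" for u v
      using that A.word_eval_replicate[OF b] d_gt_1
      by (auto simp: R_def b_def affine_translation_pow affine_rotation_pow affine_rotation_inv[simplified])
    assume "a Gen_x = \<one>\<^bsub>P\<^esub>"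
    then have "word_eval P a [(Gen_x, False)] = word_eval P a []" by simp
    then have "{v. pres_eq R [] v} = {v. pres_eq R [(Gen_x, False)] v}" unfolding cls(2) by simp
    then have "pres_eq R [(Gen_x, False)] []" using pres_eq.refl[of R "[]"] by blast
    from pres_eq_word_eval[OF group_affine b R this] show False
      using p_gt_1 by (simp add: b_def)
  qed
  define f where "f = (\<lambda>(i::nat, j::nat). a Gen_x [^]\<^bsub>P\<^esub> i \<otimes>\<^bsub>P\<^esub> a Gen_y [^]\<^bsub>P\<^esub> j)"
  note emb = affine_embedding[OF P.is_group a a x y xy nontrivial, folded f_def]
  interpret f: group_hom affine_group P f
    using emb group_affine by (simp add: group_hom_def group_hom_axioms_def P.is_group)
  have img: "subgroup (f ` carrier affine_group) P" by (rule f.img_is_subgroup)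
  have "a Gen_x = f (1, 0)" "a Gen_y = f (0, 1)" using a by (simp_all add: f_def)
  moreover have "(1, 0) \<in> carrier affine_group" "(0, 1) \<in> carrier affine_group"
    using p_gt_1 d_gt_1 by auto
  ultimately have "a Gen_x \<in> f ` carrier affine_group" "a Gen_y \<in> f ` carrier affine_group"
    by blast+
  then have "a g \<in> f ` carrier affine_group" for g by (cases g) simp_all
  then have "carrier P \<subseteq> f ` carrier affine_group"
    unfolding cls(3) by (intro image_subsetI P.word_eval_in_subgroup[OF img]) blast
  moreover have "f ` carrier affine_group \<subseteq> carrier P" by (rule subgroup.subset[OF img])
  ultimately have "f \<in> iso affine_group P"
    unfolding iso_def bij_betw_def using emb by simp
  then show "affine_group \<cong> G_pd p d q" unfolding GP is_iso_def by blast
qed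


section \<open>The laws that define the product of Ab(p) and Ab(d)\<close>

text \<open>
  Members of pseudovarieties live on the natural numbers; this lets other groups be
  compared with them.
\<close>

lemma ex_nat_copy:
  assumes G: "group G" "finite (carrier G)"
  obtains K :: "nat monoid" where "group K" "finite (carrier K)" "G \<cong> K"
proof -
  obtain b :: "'a \<Rightarrow> nat" where b: "inj_on b (carrier G)"
    using finite_imp_inj_to_nat_seg[OF G(2)] by blast
  define K where "K = \<lparr>carrier = b ` carrier G,
     monoid.mult = (\<lambda>x y. b (inv_into (carrier G) b x \<otimes>\<^bsub>G\<^esub> inv_into (carrier G) b y)),
     one = b \<one>\<^bsub>G\<^esub>\<rparr>"
  have "b \<in> hom G K"
  proof (rule homI)
    fix x y assume "x \<in> carrier G" "y \<in> carrier G"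
    then show "b (x \<otimes>\<^bsub>G\<^esub> y) = b x \<otimes>\<^bsub>K\<^esub> b y" by (simp only: K_def monoid.simps inv_into_f_f[OF b])
  qed (simp only: K_def partial_object.simps imageI)
  moreover have "bij_betw b (carrier G) (carrier K)"
    unfolding K_def partial_object.simps using b by (rule inj_on_imp_bij_betw)
  ultimately have "b \<in> iso G K" by (simp only: iso_def mem_Collect_eq)
  then have "G \<cong> K" and "group (K\<lparr>one := b \<one>\<^bsub>G\<^esub>\<rparr>)"
    using group.iso_imp_img_group[OF G(1)] by (auto simp: is_iso_def)
  moreover have "K\<lparr>one := b \<one>\<^bsub>G\<^esub>\<rparr> = K" by (simp add: K_def)
  moreover have "finite (carrier K)" using G(2) by (simp add: K_def)
  ultimately show ?thesis using that[of K] by simp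
qed

lemma pv_generated_subset_iso:
  assumes "group G" "group H" "finite (carrier G)" "finite (carrier H)" "G \<cong> H"
  shows "pv_generated G \<subseteq> pv_generated H"
proof -
  obtain K :: "nat monoid" where K: "group K" "G \<cong> K" using ex_nat_copy[OF assms(1,3)] by metis
  have "H \<cong> K" using assms K by (metis group.iso_sym iso_trans)
  then have "K \<in> pv_generated H" using assms K pv_generated_contains by blast
  then show ?thesis
    using pv_generated_least[OF pseudovariety_pv_generated[OF assms(2,4)]] K assms by blast
qed

lemma pv_generated_iso:
  assumes "group G" "group H" "finite (carrier G)" "finite (carrier H)" "G \<cong> H"
  shows "pv_generated G = pv_generated H"
  using pv_generated_subset_iso assms by (metis group.iso_sym subset_antisym)

lemma satisfies_iso:
  fixes l :: "'g word \<times> 'g word"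
  assumes "group G" "group H" "G \<cong> H" "satisfies H l"
  shows "satisfies G l"
proof -
  from assms(3) obtain h where "h \<in> iso G H" by (auto simp: is_iso_def)
  then have "h \<in> hom G H" "inj_on h (carrier G)" by (auto simp: iso_def bij_betw_def)
  then show ?thesis using satisfies_inj_hom assms by blast
qed

text \<open>
  For coprime \<open>p\<close> and \<open>d\<close> these three laws define the finite groups in \<open>Ab p \<^bold>* Ab d\<close>. The
  obvious condition, that elements killed by \<open>p\<close> commute, is not a law; it becomes one because under
  the first law the elements killed by \<open>p\<close> are exactly the \<open>d\<close>-th powers.
\<close>

definition metab_laws :: "nat \<Rightarrow> nat \<Rightarrow> (gens word \<times> gens word) set" where
  "metab_laws p d = {power_law (d * p), commutator_power_law p, powers_commute_law d d}"

text \<open>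
  The laws hold in every extension of an abelian group of exponent dividing \<open>p\<close> by an abelian
  group of exponent dividing \<open>d\<close>, here expressed through the elements of the kernel \<open>N\<close>.
\<close>

lemma (in group) metab_lawsI:
  assumes "\<And>x. x \<in> carrier G \<Longrightarrow> x [^] d \<in> N"
    and "\<And>x y. x \<in> carrier G \<Longrightarrow> y \<in> carrier G \<Longrightarrow> x \<otimes> y \<otimes> inv x \<otimes> inv y \<in> N"
    and "\<And>x y. x \<in> N \<Longrightarrow> y \<in> N \<Longrightarrow> x \<otimes> y = y \<otimes> x"
    and "\<And>x. x \<in> N \<Longrightarrow> x [^] p = \<one>"
    and "l \<in> metab_laws p d"
  shows "satisfies G l"
proof -
  have "x [^] (d * p) = \<one>" if "x \<in> carrier G" for x
    using assms(1,4) that by (metis nat_pow_pow)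
  then show ?thesis
    using assms
    by (auto simp: metab_laws_def satisfies_power_law satisfies_powers_commute_law
        satisfies_commutator_power_law)
qed

lemma (in affine_params) affine_metab_laws: "l \<in> metab_laws p d \<Longrightarrow> satisfies affine_group l"
proof -
  interpret group affine_group by (rule group_affine)
  \<comment> \<open>The translations.\<close>
  let ?N = "{..<p} \<times> {0}"
  have sinv: "(snd (inv\<^bsub>affine_group\<^esub> x) + snd x) mod d = 0" if "x \<in> carrier affine_group" for x
  proof -
    obtain a b where "inv\<^bsub>affine_group\<^esub> x = (a, b)" by force
    then show ?thesis using l_inv[OF that] by (cases x) (simp split: prod.splits)
  qed
  have smult: "snd (x \<otimes>\<^bsub>affine_group\<^esub> y) = (snd x + snd y) mod d" for x y by (cases x; cases y) simp
  show "l \<in> metab_laws p d \<Longrightarrow> satisfies affine_group l"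
  proof (rule metab_lawsI[where N = ?N])
    fix x assume x: "x \<in> carrier affine_group"
    have "x [^]\<^bsub>affine_group\<^esub> d \<in> carrier affine_group" using x by (rule nat_pow_closed)
    then show "x [^]\<^bsub>affine_group\<^esub> d \<in> ?N" using snd_affine_pow[OF x, of d] by (auto simp: mem_Times_iff)
  next
    fix x y assume xy: "x \<in> carrier affine_group" "y \<in> carrier affine_group"
    let ?c = "x \<otimes>\<^bsub>affine_group\<^esub> y \<otimes>\<^bsub>affine_group\<^esub> inv\<^bsub>affine_group\<^esub> x \<otimes>\<^bsub>affine_group\<^esub> inv\<^bsub>affine_group\<^esub> y"
    let ?x' = "snd (inv\<^bsub>affine_group\<^esub> x)" and ?y' = "snd (inv\<^bsub>affine_group\<^esub> y)"
    have "snd ?c = ((?x' + snd x) + (?y' + snd y)) mod d"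
      by (simp add: smult mod_simps add_ac)
    also have "\<dots> = ((?x' + snd x) mod d + (?y' + snd y) mod d) mod d" by (rule mod_add_eq[symmetric])
    finally have "snd ?c = ((?x' + snd x) mod d + (?y' + snd y) mod d) mod d" .
    then have "snd ?c = 0" using sinv xy by simp
    moreover have "?c \<in> carrier affine_group" using xy by (intro m_closed inv_closed)
    ultimately show "?c \<in> ?N" by (auto simp: mem_Times_iff)
  qed (auto simp: affine_translation_pow add.commute)
qed

locale metab_group = affine_params p d q + group G for p d q :: nat and G (structure) +
  assumes laws: "l \<in> metab_laws p d \<Longrightarrow> satisfies G l"

context metab_group begin

text \<open>
  In an extension of an abelian group of exponent \<open>p\<close> by one of exponent \<open>d\<close>, with \<open>p\<close> and
  \<open>d\<close> coprime, this set is the only possible kernel. The laws make it an abelian normal subgroup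
  with abelian quotient.
\<close>

definition N where "N = {x \<in> carrier G. x [^] p = \<one>}"

lemma pow_dp: "x \<in> carrier G \<Longrightarrow> x [^] (d * p) = \<one>"
  using laws[of "power_law (d * p)"] by (simp add: metab_laws_def satisfies_power_law)

lemma commutator_in_N:
  "x \<in> carrier G \<Longrightarrow> y \<in> carrier G \<Longrightarrow> x \<otimes> y \<otimes> inv x \<otimes> inv y \<in> N"
  using laws[of "commutator_power_law p"] by (simp add: metab_laws_def satisfies_commutator_power_law N_def)

lemma pow_d_commute:
  "x \<in> carrier G \<Longrightarrow> y \<in> carrier G \<Longrightarrow> x [^] d \<otimes> y [^] d = y [^] d \<otimes> x [^] d"
  using laws[of "powers_commute_law d d"] by (simp add: metab_laws_def satisfies_powers_commute_law)

lemma pow_d_in_N: "x \<in> carrier G \<Longrightarrow> x [^] d \<in> N"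
  using pow_dp by (simp add: N_def nat_pow_pow)

lemma N_carrier: "x \<in> N \<Longrightarrow> x \<in> carrier G" by (simp add: N_def)

lemma pow_d_eq_one: "x \<in> N \<Longrightarrow> x [^] d = \<one> \<Longrightarrow> x = \<one>"
  using coprime_pow_eq_one[of x p d] coprime_p_d by (simp add: N_def)

text \<open>
  The map \<open>y \<mapsto> y\<^sup>d\<close> is onto \<open>N\<close> because \<open>d\<close> is invertible modulo \<open>p\<close>. This is what turns
  the commuting of \<open>d\<close>-th powers into the commuting of \<open>N\<close>.
\<close>

lemma N_eq_pow_d:
  assumes "x \<in> N"
  obtains y where "y \<in> N" "x = y [^] d"
proof -
  obtain k where k: "[d * k = 1] (mod p)"
    using coprime_p_d cong_solve_coprime_nat[of d p] by (auto simp: coprime_commute)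
  have x: "x \<in> carrier G" "x [^] p = \<one>" using assms by (auto simp: N_def)
  have "(x [^] k) [^] d = x [^] (d * k)" using x by (simp add: nat_pow_pow mult.commute)
  also have "\<dots> = x" using pow_cong[OF x k] x by simp
  finally have "x = (x [^] k) [^] d" ..
  moreover have "(x [^] k) [^] p = \<one>" using x by (metis mult.commute nat_pow_one nat_pow_pow)
  then have "x [^] k \<in> N" using x by (simp add: N_def)
  ultimately show ?thesis using that by blast
qed

lemma N_commute: "x \<in> N \<Longrightarrow> y \<in> N \<Longrightarrow> x \<otimes> y = y \<otimes> x"
  by (metis N_carrier N_eq_pow_d pow_d_commute)

lemma N_pow_cong: "x \<in> N \<Longrightarrow> [i = j] (mod p) \<Longrightarrow> x [^] i = x [^] j"
  by (rule pow_cong) (auto simp: N_def)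

lemma N_pow_eq_iff: "x \<in> N \<Longrightarrow> x \<noteq> \<one> \<Longrightarrow> x [^] i = x [^] j \<longleftrightarrow> [i = j] (mod p)"
  by (rule prime_pow_eq_iff) (auto simp: N_def prime_p)

lemma subgroup_N: "subgroup N G"
proof (rule subgroupI)
  show "N \<noteq> {}" by (auto simp: N_def intro!: exI[of _ \<one>])
next
  fix x y assume "x \<in> N" "y \<in> N"
  then show "x \<otimes> y \<in> N" by (simp add: N_def pow_mult_distrib N_commute)
qed (auto simp: N_def nat_pow_inv)

lemma N_mult_closed: "x \<in> N \<Longrightarrow> y \<in> N \<Longrightarrow> x \<otimes> y \<in> N"
  by (rule subgroup.m_closed[OF subgroup_N])

lemma N_pow_closed: "x \<in> N \<Longrightarrow> x [^] (n::nat) \<in> N"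
  by (induction n) (auto simp: subgroup.one_closed[OF subgroup_N] subgroup.m_closed[OF subgroup_N])

lemma N_pow_mult: "x \<in> N \<Longrightarrow> y \<in> N \<Longrightarrow> (x \<otimes> y) [^] (n::nat) = x [^] n \<otimes> y [^] n"
  by (rule pow_mult_distrib) (rule N_commute N_carrier; assumption)+

lemma conj_N: "k \<in> carrier G \<Longrightarrow> x \<in> N \<Longrightarrow> k \<otimes> x \<otimes> inv k \<in> N"
  by (simp add: N_def conj_pow)

lemma normal_N: "N \<lhd> G"
  using conj_N subgroup_N by (simp add: normal_inv_iff)

lemma N_conj_N: "k \<in> N \<Longrightarrow> x \<in> N \<Longrightarrow> k \<otimes> x \<otimes> inv k = x"
  by (subst conj_eq_iff_commute) (rule N_commute N_carrier; assumption)+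

end

text \<open>
  If the kernel is \<open>N\<close> and the quotient is abelian of exponent dividing \<open>d\<close>, then \<open>N\<close> contains
  all commutators and all \<open>d\<close>-th powers, which gives the laws. Conversely, under the laws the
  set of elements killed by \<open>p\<close> is the required kernel.
\<close>

lemma (in affine_params) pv_product_Ab_metab_laws:
  "Ab p \<^bold>* Ab d =
     {K. group K \<and> finite (carrier K) \<and> (\<forall>l\<in>metab_laws p d. satisfies K l)}"
proof (intro equalityI subsetI)
  fix K assume "K \<in> Ab p \<^bold>* Ab d"
  then obtain N Q where K: "group K" "finite (carrier K)" and N: "N \<lhd> K" "K\<lparr>carrier := N\<rparr> \<in> Ab p"
    and Q: "Q \<in> Ab d" "K Mod N \<cong> Q" by (auto simp: pv_product_def)
  interpret group K by fact
  interpret N: normal N K by fact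
  interpret Q: comm_group Q using Q by (simp add: Ab_def)
  from Q(2) obtain \<phi> where \<phi>: "\<phi> \<in> iso (K Mod N) Q" by (auto simp: is_iso_def)
  define \<psi> where "\<psi> = \<phi> \<circ> (\<lambda>x. N #>\<^bsub>K\<^esub> x)"
  have "\<psi> \<in> hom K Q"
    unfolding \<psi>_def using N.r_coset_hom_Mod \<phi> by (intro Group.hom_compose[where H = "K Mod N"]) (auto simp: iso_def)
  then interpret \<psi>: group_hom K Q \<psi> by (simp add: group_hom_def group_hom_axioms_def is_group Q.is_group)
  interpret M: group "K Mod N" by (rule N.factorgroup_is_group)
  have "\<phi> \<in> hom (K Mod N) Q" "inj_on \<phi> (carrier (K Mod N))" using \<phi> by (auto simp: iso_def bij_betw_def)
  then interpret \<phi>: group_hom "K Mod N" Q \<phi> by (simp add: group_hom_def group_hom_axioms_def M.is_group Q.is_group)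
  have ker: "x \<in> N" if x: "x \<in> carrier K" "\<psi> x = \<one>\<^bsub>Q\<^esub>" for x
  proof -
    have "N #>\<^bsub>K\<^esub> x \<in> carrier (K Mod N)" using x by (auto simp: carrier_FactGroup)
    then have "N #>\<^bsub>K\<^esub> x = N"
      using x(2) \<phi>.inj_on_one_iff \<open>inj_on \<phi> (carrier (K Mod N))\<close> by (auto simp: \<psi>_def)
    then show ?thesis using x N.is_subgroup by (simp add: rcos_eq_self_iff)
  qed
  have "satisfies K l" if "l \<in> metab_laws p d" for l
  proof (rule metab_lawsI[OF _ _ _ _ that, where N = N])
    fix x assume x: "x \<in> carrier K"
    have "\<psi> x [^]\<^bsub>Q\<^esub> d = \<one>\<^bsub>Q\<^esub>" using Q(1) x by (simp add: Ab_def)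
    then show "x [^]\<^bsub>K\<^esub> d \<in> N" using x by (intro ker) (auto simp: \<psi>.hom_nat_pow)
  next
    fix x y assume xy: "x \<in> carrier K" "y \<in> carrier K"
    then have "\<psi> x \<otimes>\<^bsub>Q\<^esub> \<psi> y = \<psi> y \<otimes>\<^bsub>Q\<^esub> \<psi> x" by (simp add: Q.m_comm)
    then have "\<psi> x \<otimes>\<^bsub>Q\<^esub> \<psi> y \<otimes>\<^bsub>Q\<^esub> inv\<^bsub>Q\<^esub> \<psi> x \<otimes>\<^bsub>Q\<^esub> inv\<^bsub>Q\<^esub> \<psi> y = \<one>\<^bsub>Q\<^esub>"
      using xy by (subst Q.commutator_eq_one_iff) simp_all
    then show "x \<otimes>\<^bsub>K\<^esub> y \<otimes>\<^bsub>K\<^esub> inv\<^bsub>K\<^esub> x \<otimes>\<^bsub>K\<^esub> inv\<^bsub>K\<^esub> y \<in> N"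
      using xy by (intro ker) simp_all
  next
    fix x y assume xy: "x \<in> N" "y \<in> N"
    interpret A: comm_group "K\<lparr>carrier := N\<rparr>" using N by (simp add: Ab_def)
    show "x \<otimes>\<^bsub>K\<^esub> y = y \<otimes>\<^bsub>K\<^esub> x" using A.m_comm[of x y] xy by simp
  next
    fix x assume "x \<in> N"
    then show "x [^]\<^bsub>K\<^esub> p = \<one>\<^bsub>K\<^esub>"
      using N(2) by (simp add: Ab_def flip: nat_pow_consistent)
  qed
  with K show "K \<in> {K. group K \<and> finite (carrier K) \<and> (\<forall>l\<in>metab_laws p d. satisfies K l)}" by simp
next
  fix K :: "nat monoid"
  assume K: "K \<in> {K. group K \<and> finite (carrier K) \<and> (\<forall>l\<in>metab_laws p d. satisfies K l)}"
  then interpret group K by simp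
  interpret metab_group p d q K using K by unfold_locales simp
  interpret N: normal N K by (rule normal_N)
  interpret A: group "K\<lparr>carrier := N\<rparr>" using subgroup_N is_group by (rule subgroup.subgroup_is_group)
  have "comm_group (K\<lparr>carrier := N\<rparr>)" 
  proof (rule A.group_comm_groupI)
    fix x y assume "x \<in> carrier (K\<lparr>carrier := N\<rparr>)" "y \<in> carrier (K\<lparr>carrier := N\<rparr>)"
    then have "x \<otimes>\<^bsub>K\<^esub> y = y \<otimes>\<^bsub>K\<^esub> x" by (intro N_commute) auto
    then show "x \<otimes>\<^bsub>K\<lparr>carrier := N\<rparr>\<^esub> y = y \<otimes>\<^bsub>K\<lparr>carrier := N\<rparr>\<^esub> x" by simp
  qed
  moreover have "finite N"
  proof (rule finite_subset)
    show "N \<subseteq> carrier K" by (rule subsetI) (rule N_carrier)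
    show "finite (carrier K)" using K by simp
  qed
  moreover have "x [^]\<^bsub>K\<lparr>carrier := N\<rparr>\<^esub> p = \<one>\<^bsub>K\<^esub>" if "x \<in> N" for x
  proof -
    have "x [^]\<^bsub>K\<^esub> p = \<one>\<^bsub>K\<^esub>" using that unfolding N_def by blast
    then show ?thesis using nat_pow_consistent[of x p N] by (rule back_subst)
  qed
  ultimately have "K\<lparr>carrier := N\<rparr> \<in> Ab p" by (simp add: Ab_def)
  have "finite (carrier (K Mod N))" using K by (simp add: carrier_FactGroup)
  then obtain Q :: "nat monoid" where Q: "group Q" "finite (carrier Q)" "K Mod N \<cong> Q"
    by (rule ex_nat_copy[OF N.factorgroup_is_group])
  from Q(3) obtain \<phi> where \<phi>: "\<phi> \<in> iso (K Mod N) Q" by (auto simp: is_iso_def)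
  define \<psi> where "\<psi> = \<phi> \<circ> (\<lambda>x. N #>\<^bsub>K\<^esub> x)"
  have hom: "\<psi> \<in> hom K Q"
    unfolding \<psi>_def using N.r_coset_hom_Mod \<phi> by (intro Group.hom_compose[where H = "K Mod N"]) (auto simp: iso_def)
  interpret Q: group Q by fact
  interpret M: group "K Mod N" by (rule N.factorgroup_is_group)
  interpret \<psi>: group_hom K Q \<psi> using hom by (simp add: group_hom_def group_hom_axioms_def is_group Q.is_group)
  interpret \<phi>: group_hom "K Mod N" Q \<phi>
    using \<phi> by (simp add: group_hom_def group_hom_axioms_def M.is_group Q.is_group iso_def)
  have surj: "carrier Q = \<psi> ` carrier K"
  proof -
    have "carrier Q = \<phi> ` carrier (K Mod N)" using \<phi> by (simp add: iso_def bij_betw_def)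
    then show ?thesis by (simp only: \<psi>_def carrier_FactGroup image_comp)
  qed
  have ker: "\<psi> x = \<one>\<^bsub>Q\<^esub>" if "x \<in> N" for x
  proof -
    have "N #>\<^bsub>K\<^esub> x = \<one>\<^bsub>K Mod N\<^esub>" using that N_carrier subgroup_N by (simp add: rcos_eq_self_iff)
    then show ?thesis unfolding \<psi>_def comp_def by (simp only: \<phi>.hom_one)
  qed
  have "comm_group Q"
  proof (rule Q.group_comm_groupI)
    fix a b assume "a \<in> carrier Q" "b \<in> carrier Q"
    then obtain x y where xy: "x \<in> carrier K" "y \<in> carrier K" "a = \<psi> x" "b = \<psi> y" by (auto simp: surj)
    have "a \<otimes>\<^bsub>Q\<^esub> b \<otimes>\<^bsub>Q\<^esub> inv\<^bsub>Q\<^esub> a \<otimes>\<^bsub>Q\<^esub> inv\<^bsub>Q\<^esub> b = \<one>\<^bsub>Q\<^esub>"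
      using ker[OF commutator_in_N[OF xy(1,2)]] xy by simp
    then show "a \<otimes>\<^bsub>Q\<^esub> b = b \<otimes>\<^bsub>Q\<^esub> a"
      using xy by (simp add: Q.commutator_eq_one_iff)
  qed
  moreover have "a [^]\<^bsub>Q\<^esub> d = \<one>\<^bsub>Q\<^esub>" if "a \<in> carrier Q" for a
    using that ker[OF pow_d_in_N] by (auto simp: surj \<psi>.hom_nat_pow)
  ultimately have "Q \<in> Ab d" using Q by (simp add: Ab_def)
  with Q(3) \<open>K\<lparr>carrier := N\<rparr> \<in> Ab p\<close> normal_N K
  show "K \<in> Ab p \<^bold>* Ab d" by (auto simp: pv_product_def)
qed


section \<open>Separation of elements and monolithic groups\<close>

text \<open>
  A finite group whose elements are separated by homomorphisms to \<open>G\<close> embeds in a finite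
  direct power of \<open>G\<close>, with one factor for each nontrivial element.
\<close>

lemma pv_generated_residual:
  assumes G: "group G" and K: "group K" "finite (carrier K)"
    and sep: "\<And>g. g \<in> carrier K \<Longrightarrow> g \<noteq> \<one>\<^bsub>K\<^esub> \<Longrightarrow> \<exists>\<phi>\<in>hom K G. \<phi> g \<noteq> \<one>\<^bsub>G\<^esub>"
  shows "K \<in> pv_generated G"
proof -
  define I where "I = carrier K - {\<one>\<^bsub>K\<^esub>}"
  have "\<forall>g\<in>I. \<exists>\<phi>. \<phi> \<in> hom K G \<and> \<phi> g \<noteq> \<one>\<^bsub>G\<^esub>" using sep by (auto simp: I_def)
  then obtain \<phi> where \<phi>: "\<And>g. g \<in> I \<Longrightarrow> \<phi> g \<in> hom K G" "\<And>g. g \<in> I \<Longrightarrow> \<phi> g g \<noteq> \<one>\<^bsub>G\<^esub>"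
    by metis
  let ?P = "product_group I (\<lambda>_. G)"
  define \<Phi> where "\<Phi> k = (\<lambda>g\<in>I. \<phi> g k)" for k
  have P: "group ?P" using G by simp
  have hom: "\<Phi> \<in> hom K ?P"
  proof (rule homI)
    fix x assume "x \<in> carrier K"
    then show "\<Phi> x \<in> carrier ?P" using \<phi>(1) by (auto simp: \<Phi>_def hom_def)
  next
    fix x y assume "x \<in> carrier K" "y \<in> carrier K"
    then show "\<Phi> (x \<otimes>\<^bsub>K\<^esub> y) = \<Phi> x \<otimes>\<^bsub>?P\<^esub> \<Phi> y"
      using \<phi>(1) by (auto simp: \<Phi>_def hom_def intro!: restrict_ext)
  qed
  interpret \<Phi>: group_hom K ?P \<Phi> using hom K P by (simp add: group_hom_def group_hom_axioms_def)
  have inj: "inj_on \<Phi> (carrier K)"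
    unfolding \<Phi>.inj_on_one_iff
  proof (intro allI impI, rule ccontr)
    fix g assume g: "g \<in> carrier K" "\<Phi> g = \<one>\<^bsub>?P\<^esub>" "g \<noteq> \<one>\<^bsub>K\<^esub>"
    then have "g \<in> I" by (simp add: I_def)
    with g(2) have "\<phi> g g = \<one>\<^bsub>G\<^esub>" by (metis (no_types, lifting) \<Phi>_def one_product_group restrict_apply')
    with \<phi>(2)[OF \<open>g \<in> I\<close>] show False by contradiction
  qed
  let ?S = "\<Phi> ` carrier K"
  have S: "subgroup ?S ?P" by (rule \<Phi>.img_is_subgroup)
  have "\<Phi> \<in> iso K (?P\<lparr>carrier := ?S\<rparr>)"
    using hom inj by (simp add: iso_def bij_betw_def hom_def del: carrier_product_group)
  then have "inv_into (carrier K) \<Phi> \<in> iso (?P\<lparr>carrier := ?S\<rparr>) K" by (rule group.iso_set_sym[OF K(1)])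
  then have "inv_into (carrier K) \<Phi> \<in> epi (?P\<lparr>carrier := ?S\<rparr>) K" by (simp add: iso_iff_mon_epi)
  moreover have "finite I" using K(2) by (simp add: I_def)
  ultimately show ?thesis using pv_generatedI[OF G _ S K(1)] by blast
qed

text \<open>
  An element as in this definition exists exactly when there is a least nontrivial normal
  subgroup, the monolith, and it is then one of its nontrivial elements.
\<close>

definition monolith_element :: "('a, 'b) monoid_scheme \<Rightarrow> 'a \<Rightarrow> bool" where
  "monolith_element G g \<longleftrightarrow>
     g \<in> carrier G \<and> g \<noteq> \<one>\<^bsub>G\<^esub> \<and> (\<forall>L. L \<lhd> G \<longrightarrow> L \<noteq> {\<one>\<^bsub>G\<^esub>} \<longrightarrow> g \<in> L)"

lemma (in group_hom) normal_preimage: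
  assumes "L \<lhd> H"
  shows "{x \<in> carrier G. h x \<in> L} \<lhd> G"
proof -
  interpret L: normal L H by fact
  have "subgroup {x \<in> carrier G. h x \<in> L} G"
    by (rule G.subgroupI) (auto intro!: exI[of _ \<one>])
  moreover have "h x \<otimes>\<^bsub>H\<^esub> h y \<otimes>\<^bsub>H\<^esub> inv\<^bsub>H\<^esub> h x \<in> L" if "x \<in> carrier G" "h y \<in> L" for x y
    using that by (simp add: L.inv_op_closed2)
  ultimately show ?thesis by (auto simp: G.normal_inv_iff)
qed

text \<open>
  Dividing by a normal subgroup that is maximal among those avoiding \<open>g\<close> puts \<open>g\<close> into every
  nontrivial normal subgroup. Separating \<open>g\<close> from the identity is thereby reduced to
  monolithic groups.
\<close>

lemma (in group) ex_monolithic_quotient: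
  assumes fin: "finite (carrier G)" and g: "g \<in> carrier G" "g \<noteq> \<one>"
  shows "\<exists>M. M \<lhd> G \<and> monolith_element (G Mod M) (M #> g)"
proof -
  let ?C = "{M. M \<lhd> G \<and> g \<notin> M}"
  have "?C \<subseteq> Pow (carrier G)" by (auto simp: normal_def dest: subgroup.subset)
  then have "finite ?C" by (rule finite_subset) (simp add: fin)
  moreover have "{\<one>} \<in> ?C" using g(2) one_is_normal by simp
  ultimately obtain M where M: "M \<in> ?C" and max: "\<And>L. L \<in> ?C \<Longrightarrow> M \<subseteq> L \<Longrightarrow> L = M"
    using finite_has_maximal[of ?C] by blast
  interpret M: normal M G using M by simp
  interpret Q: group "G Mod M" by (rule M.factorgroup_is_group)
  interpret \<pi>: group_hom G "G Mod M" "\<lambda>x. M #> x"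
    using M.r_coset_hom_Mod by (simp add: group_hom_def group_hom_axioms_def Q.is_group)
  have one: "M #> x = M \<longleftrightarrow> x \<in> M" if "x \<in> carrier G" for x
    using rcos_eq_self_iff[OF M.is_subgroup that] .
  have "M #> g \<in> L" if L: "L \<lhd> G Mod M" "L \<noteq> {\<one>\<^bsub>G Mod M\<^esub>}" for L
  proof (rule ccontr)
    assume gL: "M #> g \<notin> L"
    let ?L = "{x \<in> carrier G. M #> x \<in> L}"
    interpret L: normal L "G Mod M" by fact
    have "?L \<lhd> G" by (rule \<pi>.normal_preimage[OF L(1)])
    moreover have "M \<subseteq> ?L"
    proof
      fix x assume x: "x \<in> M"
      then have "x \<in> carrier G" by (rule M.mem_carrier)
      moreover from this have "M #> x = M" using one x by blast
      ultimately show "x \<in> ?L" using L.one_closed by simp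
    qed
    ultimately have LM: "?L = M" using max gL by blast
    have "L \<subseteq> {M}"
    proof
      fix c assume c: "c \<in> L"
      then have "c \<in> carrier (G Mod M)" by (rule L.mem_carrier)
      then obtain x where x: "x \<in> carrier G" "c = M #> x" by (auto simp: carrier_FactGroup)
      with c LM have "x \<in> M" by blast
      with x one show "c \<in> {M}" by simp
    qed
    with L.one_closed L(2) show False by auto
  qed
  moreover have "M #> g \<noteq> M" using M g one by simp
  moreover have "M #> g \<in> carrier (G Mod M)" using g by (auto simp: carrier_FactGroup)
  ultimately show ?thesis using M unfolding monolith_element_def by auto
qed

text \<open>
  The order \<open>r\<close> of \<open>g\<close> is prime and \<open>g\<close> generates the only subgroup of order \<open>r\<close>. Consequently
  the cyclic subgroups form a chain.
\<close>

lemma (in comm_group) monolithic_imp_cyclic: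
  assumes fin: "finite (carrier G)" and g: "monolith_element G g"
  obtains a where "a \<in> carrier G" "\<And>x. x \<in> carrier G \<Longrightarrow> \<exists>j::nat. x = a [^] j"
proof -
  have gc: "g \<in> carrier G" "g \<noteq> \<one>" using g by (auto simp: monolith_element_def)
  have mono: "\<exists>j::nat. g = x [^] j" if x: "x \<in> carrier G" "x \<noteq> \<one>" for x
  proof -
    have "subgroup (generate G {x}) G" using x by (intro generate_is_subgroup) auto
    then have "generate G {x} \<lhd> G" by (simp add: normal_iff_subgroup)
    moreover have "x \<in> generate G {x}" by (rule generate.incl) simp
    ultimately have "g \<in> generate G {x}" using g x unfolding monolith_element_def by blast
    then show ?thesis using mem_generate_iff[OF fin x(1)] by blast
  qed
  have "group.ord G g \<noteq> 1" using gc ord_eq_1 by simp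
  then obtain r where r: "prime r" "r dvd group.ord G g" by (metis prime_factor_nat)
  \<comment> \<open>\<open>g\<close> has prime order, since otherwise it would be a power of \<open>g\<^sup>r\<close>.\<close>
  have gr: "g [^] r = \<one>"
  proof (rule ccontr)
    assume "g [^] r \<noteq> \<one>"
    then obtain j :: nat where "g = (g [^] r) [^] j" using mono[of "g [^] r"] gc by auto
    then have "g [^] (r * j) = g [^] (1::nat)" using gc by (simp add: nat_pow_pow)
    then have "[r * j = 1] (mod group.ord G g)" using nat_pow_eq_iff[OF gc(1)] by blast
    then have "[r * j = 1] (mod r)" using r(2) by (rule cong_dvd_modulus_nat)
    then have "[0 = 1] (mod r)" by (simp add: cong_def)
    with prime_gt_1_nat[OF r(1)] show False by (simp add: cong_def)
  qed
  have "group.ord G g dvd r" using gr gc by (simp add: pow_eq_id)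
  with r have og: "group.ord G g = r" by (simp add: dvd_antisym)
  have r_dvd: "r dvd group.ord G x" if x: "x \<in> carrier G" "x \<noteq> \<one>" for x
  proof -
    obtain j :: nat where j: "g = x [^] j" using mono[OF x] by blast
    have "g [^] group.ord G x = (x [^] group.ord G x) [^] j"
      unfolding j using x by (simp only: nat_pow_pow mult.commute[of j])
    then have "g [^] group.ord G x = \<one>" using x by simp
    then show ?thesis using gc og by (simp add: pow_eq_id)
  qed
  \<comment> \<open>Any two cyclic subgroups are comparable: by induction the cyclic subgroups of the \<open>r\<close>-th
    powers are, say \<open>u ^ r = v ^ (r * j)\<close>; then \<open>u * v ^ (- j)\<close> has order dividing \<open>r\<close>, hence lies
    in the only subgroup of order \<open>r\<close>, which is contained in that of \<open>v\<close>.\<close>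
  have chain: "(\<exists>j::nat. x = y [^] j) \<or> (\<exists>j::nat. y = x [^] j)"
    if "x \<in> carrier G" "y \<in> carrier G" for x y
    using that
  proof (induction "group.ord G x" arbitrary: x y rule: less_induct)
    case less
    have step: "\<exists>j::nat. u = v [^] j"
      if uv: "u \<in> carrier G" "v \<in> carrier G" "v \<noteq> \<one>" "u [^] r = (v [^] r) [^] j" for u v and j :: nat
    proof -
      let ?c = "u \<otimes> inv (v [^] j)"
      have "?c [^] r = u [^] r \<otimes> inv ((v [^] r) [^] j)"
        using uv by (simp add: nat_pow_distrib nat_pow_inv nat_pow_pow mult.commute)
      then have c: "?c \<in> carrier G" "?c [^] r = \<one>" using uv by simp_all
      obtain m :: nat where m: "?c = v [^] m"
      proof (cases "?c = \<one>")
        case True then show ?thesis using that[of 0] by simp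
      next
        case False
        obtain k :: nat where k: "g = ?c [^] k" using mono[OF c(1) False] by blast
        obtain l :: nat where l: "g = v [^] l" using mono[OF uv(2,3)] by blast
        have "\<not> r dvd k"
        proof
          assume "r dvd k"
          then obtain t where "k = r * t" by (elim dvdE)
          then have "g = (?c [^] r) [^] t" using k c(1) by (simp add: nat_pow_pow)
          with c gc show False by simp
        qed
        then have "coprime k r" using r(1) by (metis coprime_commute prime_imp_coprime)
        then obtain s where s: "[k * s = 1] (mod r)" using cong_solve_coprime_nat[of k r] by auto
        have "?c = ?c [^] (k * s)" using pow_cong[OF c s] c by simp
        also have "\<dots> = g [^] s" using c k by (simp add: nat_pow_pow)
        also have "\<dots> = v [^] (l * s)" using l uv by (simp add: nat_pow_pow)
        finally show ?thesis by (rule that)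
      qed
      have "u = ?c \<otimes> v [^] j" using uv by (simp add: m_assoc)
      also have "\<dots> = v [^] (m + j)" using uv unfolding m by (simp add: nat_pow_mult)
      finally show ?thesis by blast
    qed
    show ?case
    proof (cases "x = \<one> \<or> y = \<one>")
      case True
      then show ?thesis using less.prems by (metis nat_pow_0)
    next
      case False
      have "r > 1" using r(1) by (rule prime_gt_1_nat)
      moreover have "group.ord G x \<ge> 1" using ord_ge_1[OF fin less.prems(1)] .
      moreover have "group.ord G (x [^] r) = group.ord G x div r"
        using ord_pow_gen[OF less.prems(1), of r] r_dvd[of x] less.prems False \<open>r > 1\<close>
        by (simp add: gcd_nat.absorb2)
      ultimately have "group.ord G (x [^] r) < group.ord G x" by simp
      from less.hyps[OF this, of "y [^] r"] less.prems
      consider j :: nat where "x [^] r = (y [^] r) [^] j" | j :: nat where "y [^] r = (x [^] r) [^] j"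
        by auto
      then show ?thesis using step less.prems False by cases blast+
    qed
  qed
  \<comment> \<open>In a finite chain of cyclic subgroups the largest one is everything.\<close>
  define P where "P x = range (\<lambda>j::nat. x [^] j)" for x
  have Psub: "P y \<subseteq> P x" if "x \<in> carrier G" "y \<in> P x" for x y
    using that by (auto simp: P_def nat_pow_pow)
  have Pfin: "finite (P x)" if "x \<in> carrier G" for x
    using that by (intro finite_subset[OF _ fin]) (auto simp: P_def)
  have Pself: "x \<in> P x" if "x \<in> carrier G" for x
    unfolding P_def by (rule range_eqI[of _ _ 1]) (use that in simp)
  obtain a where a: "a \<in> carrier G" "\<And>x. x \<in> carrier G \<Longrightarrow> card (P x) \<le> card (P a)"
  proof -
    have "\<forall>x. x \<in> carrier G \<longrightarrow> card (P x) < Suc (card (carrier G))"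
      using fin by (auto simp: P_def less_Suc_eq_le intro!: card_mono)
    from ex_has_greatest_nat[of "\<lambda>x. x \<in> carrier G", OF gc(1) this] show ?thesis using that by blast
  qed
  have "x \<in> P a" if x: "x \<in> carrier G" for x
  proof (cases "x \<in> P a")
    case False
    then have "a \<in> P x" using chain[OF x a(1)] by (auto simp: P_def)
    then have "P a \<subseteq> P x" by (rule Psub[OF x])
    then have "P a = P x" using card_seteq[OF Pfin[OF x]] a(2)[OF x] by blast
    with Pself[OF x] show ?thesis by simp
  qed
  then show ?thesis using that[OF a(1)] by (auto simp: P_def)
qed


section \<open>The action on the elements of order p is diagonalisable\<close>

text \<open>
  Written additively this is \<open>(c 0 + c 1 T + \<dots> + c (m - 1) T ^ (m - 1)) x\<close> where \<open>T\<close> is conjugation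
  by \<open>k\<close>: the value at \<open>x\<close> of a polynomial in \<open>T\<close>. It allows the spectral projections of \<open>T\<close> to
  be used without viewing \<open>N\<close> as a vector space.
\<close>

primrec (in group) orbit_prod :: "'a \<Rightarrow> 'a \<Rightarrow> (nat \<Rightarrow> nat) \<Rightarrow> nat \<Rightarrow> 'a" where
  "orbit_prod k x c 0 = \<one>"
| "orbit_prod k x c (Suc m) = orbit_prod k x c m \<otimes> (k [^] m \<otimes> x \<otimes> inv (k [^] m)) [^] c m"

context metab_group begin

text \<open>
  The action on \<open>N\<close> factors through the abelian quotient by \<open>N\<close>. Therefore eigenspaces of one
  element are invariant under all of \<open>G\<close>.
\<close>

lemma conj_comm:
  assumes k: "k \<in> carrier G" and h: "h \<in> carrier G" and x: "x \<in> N"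
  shows "k \<otimes> (h \<otimes> x \<otimes> inv h) \<otimes> inv k = h \<otimes> (k \<otimes> x \<otimes> inv k) \<otimes> inv h"
proof -
  let ?c = "k \<otimes> h \<otimes> inv k \<otimes> inv h"
  have c: "?c \<in> N" by (rule commutator_in_N[OF k h])
  have y: "h \<otimes> (k \<otimes> x \<otimes> inv k) \<otimes> inv h \<in> N" using assms by (intro conj_N)
  have "k \<otimes> h = ?c \<otimes> (h \<otimes> k)"
  proof -
    have "?c = (k \<otimes> h) \<otimes> inv (h \<otimes> k)" using k h by (simp add: m_assoc inv_mult_group)
    then show ?thesis using k h by (simp add: m_assoc)
  qed
  then have "k \<otimes> (h \<otimes> x \<otimes> inv h) \<otimes> inv k = (?c \<otimes> (h \<otimes> k)) \<otimes> x \<otimes> inv (?c \<otimes> (h \<otimes> k))"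
    using conj_conj[OF k h N_carrier[OF x]] by (simp only:)
  also have "\<dots> = ?c \<otimes> ((h \<otimes> k) \<otimes> x \<otimes> inv (h \<otimes> k)) \<otimes> inv ?c"
    by (rule conj_conj[symmetric]) (use k h N_carrier[OF x] in simp_all)
  also have "(h \<otimes> k) \<otimes> x \<otimes> inv (h \<otimes> k) = h \<otimes> (k \<otimes> x \<otimes> inv k) \<otimes> inv h"
    by (rule conj_conj[symmetric, OF h k N_carrier[OF x]])
  also have "?c \<otimes> (h \<otimes> (k \<otimes> x \<otimes> inv k) \<otimes> inv h) \<otimes> inv ?c = h \<otimes> (k \<otimes> x \<otimes> inv k) \<otimes> inv h"
    by (rule N_conj_N[OF c y])
  finally show ?thesis .
qed

lemma orbit_prod_in_N:
  assumes "k \<in> carrier G" "x \<in> N"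
  shows "orbit_prod k x c m \<in> N"
proof (induction m)
  case 0 show ?case by (simp add: subgroup.one_closed[OF subgroup_N])
next
  case (Suc m)
  then show ?case using assms by (auto intro!: N_mult_closed N_pow_closed conj_N)
qed

lemma orbit_prod_add:
  assumes k: "k \<in> carrier G" and x: "x \<in> N"
  shows "orbit_prod k x (\<lambda>j. c j + c' j) m = orbit_prod k x c m \<otimes> orbit_prod k x c' m"
proof (induction m)
  case (Suc m)
  let ?t = "k [^] m \<otimes> x \<otimes> inv (k [^] m)"
  have t: "?t \<in> N" using k x by (intro conj_N) auto
  note o = orbit_prod_in_N[OF k x]
  have "orbit_prod k x (\<lambda>j. c j + c' j) (Suc m)
    = (orbit_prod k x c m \<otimes> orbit_prod k x c' m) \<otimes> (?t [^] c m \<otimes> ?t [^] c' m)"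
    using Suc N_carrier[OF t] by (simp add: nat_pow_mult)
  also have "\<dots> = orbit_prod k x c m \<otimes> (orbit_prod k x c' m \<otimes> ?t [^] c m) \<otimes> ?t [^] c' m"
    using N_carrier[OF o] N_carrier[OF t] by (simp add: m_assoc)
  also have "orbit_prod k x c' m \<otimes> ?t [^] c m = ?t [^] c m \<otimes> orbit_prod k x c' m"
    by (rule N_commute[OF o N_pow_closed[OF t]])
  also have "orbit_prod k x c m \<otimes> (?t [^] c m \<otimes> orbit_prod k x c' m) \<otimes> ?t [^] c' m
    = orbit_prod k x c (Suc m) \<otimes> orbit_prod k x c' (Suc m)"
    using N_carrier[OF o] N_carrier[OF t] by (simp add: m_assoc)
  finally show ?case .
qed simp

lemma orbit_prod_pow:
  assumes k: "k \<in> carrier G" and x: "x \<in> N"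
  shows "orbit_prod k x c m [^] (r::nat) = orbit_prod k x (\<lambda>j. c j * r) m"
proof (induction m)
  case (Suc m)
  let ?t = "k [^] m \<otimes> x \<otimes> inv (k [^] m)"
  have t: "?t \<in> N" using k x by (intro conj_N) auto
  show ?case
    using Suc N_pow_mult[OF orbit_prod_in_N[OF k x] N_pow_closed[OF t], of c m "c m" r] N_carrier[OF t]
    by (simp add: nat_pow_pow)
qed simp

lemma orbit_prod_cong:
  assumes k: "k \<in> carrier G" and x: "x \<in> N" and c: "\<And>j. j < m \<Longrightarrow> [c j = c' j] (mod p)"
  shows "orbit_prod k x c m = orbit_prod k x c' m"
  using c
proof (induction m)
  case (Suc m)
  have t: "k [^] m \<otimes> x \<otimes> inv (k [^] m) \<in> N" using k x by (intro conj_N) auto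
  show ?case using Suc N_pow_cong[OF t Suc.prems[of m]] by simp
qed simp

lemma orbit_prod_shift:
  assumes k: "k \<in> carrier G" and x: "x \<in> N"
  shows "orbit_prod k x c (Suc m) = x [^] c 0 \<otimes> (k \<otimes> orbit_prod k x (\<lambda>j. c (Suc j)) m \<otimes> inv k)"
proof (induction m)
  case 0
  then show ?case using k N_carrier[OF x] by simp
next
  case (Suc m)
  let ?w = "orbit_prod k x (\<lambda>j. c (Suc j)) m" and ?t = "k [^] m \<otimes> x \<otimes> inv (k [^] m)"
  have w: "?w \<in> carrier G" by (rule N_carrier[OF orbit_prod_in_N[OF k x]])
  have t: "?t \<in> carrier G" using k N_carrier[OF x] by simp
  have "k \<otimes> ?t \<otimes> inv k = (k \<otimes> k [^] m) \<otimes> x \<otimes> inv (k \<otimes> k [^] m)"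
    using k N_carrier[OF x] by (intro conj_conj) auto
  also have "k \<otimes> k [^] m = k [^] Suc m" using k by (rule nat_pow_Suc2[symmetric])
  finally have T: "k [^] Suc m \<otimes> x \<otimes> inv (k [^] Suc m) = k \<otimes> ?t \<otimes> inv k" by (rule HOL.sym)
  have "orbit_prod k x c (Suc (Suc m)) = x [^] c 0 \<otimes> (k \<otimes> ?w \<otimes> inv k) \<otimes> (k \<otimes> ?t \<otimes> inv k) [^] c (Suc m)"
    unfolding orbit_prod.simps(2)[of k x c "Suc m"] T Suc.IH ..
  also have "(k \<otimes> ?t \<otimes> inv k) [^] c (Suc m) = k \<otimes> ?t [^] c (Suc m) \<otimes> inv k"
    by (rule conj_pow[OF k t])
  also have "x [^] c 0 \<otimes> (k \<otimes> ?w \<otimes> inv k) \<otimes> (k \<otimes> ?t [^] c (Suc m) \<otimes> inv k)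
    = x [^] c 0 \<otimes> ((k \<otimes> ?w \<otimes> inv k) \<otimes> (k \<otimes> ?t [^] c (Suc m) \<otimes> inv k))"
    by (rule m_assoc) (use k w t N_carrier[OF x] in simp_all)
  also have "(k \<otimes> ?w \<otimes> inv k) \<otimes> (k \<otimes> ?t [^] c (Suc m) \<otimes> inv k)
    = k \<otimes> orbit_prod k x (\<lambda>j. c (Suc j)) (Suc m) \<otimes> inv k"
    unfolding orbit_prod.simps(2) by (rule conj_mult[symmetric]) (use k w t in simp_all)
  finally show ?case .
qed

lemma orbit_prod_first:
  assumes k: "k \<in> carrier G" and x: "x \<in> N" and c: "\<And>j. 0 < j \<Longrightarrow> j < m \<Longrightarrow> p dvd c j" and m: "0 < m"
  shows "orbit_prod k x c m = x [^] c 0"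
proof -
  have triv: "orbit_prod k x (\<lambda>_. 0) n = \<one>" for n by (induction n) simp_all
  obtain m' where m': "m = Suc m'" using m by (cases m) auto
  have "orbit_prod k x c m = orbit_prod k x (\<lambda>j. if j = 0 then c 0 else 0) m"
    by (rule orbit_prod_cong[OF k x]) (use c in \<open>auto simp: cong_def\<close>)
  also have "\<dots> = x [^] c 0"
    unfolding m' orbit_prod_shift[OF k x] using k N_carrier[OF x] by (simp add: triv)
  finally show ?thesis .
qed

text \<open>
  Conjugation \<open>T\<close> by \<open>k\<close> acts on \<open>N\<close> with \<open>T\<^sup>d = 1\<close>, and the field with \<open>p\<close> elements contains
  the \<open>d\<close>-th roots of unity \<open>q\<^sup>i\<close>. Hence \<open>T\<close> is diagonalisable: additively, the vectors
  \<open>e i = (\<Sum>j<d. q ^ (- i * j) T ^ j x)\<close> are eigenvectors for \<open>q\<^sup>i\<close> whose sum is \<open>d x\<close>, and \<open>d\<close> is invertible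
  modulo \<open>p\<close>.
\<close>

lemma eigenspaces_span:
  assumes k: "k \<in> carrier G" and S: "subgroup S G"
    and eigen: "\<And>i x. i < d \<Longrightarrow> x \<in> N \<Longrightarrow> k \<otimes> x \<otimes> inv k = x [^] (q ^ i) \<Longrightarrow> x \<in> S"
  shows "N \<subseteq> S"
proof
  fix y assume "y \<in> N"
  then obtain x where x: "x \<in> N" and y: "y = x [^] d" by (rule N_eq_pow_d)
  \<comment> \<open>The exponent \<open>d - j\<close> stands for \<open>- j\<close>, because \<open>q\<^sup>d = 1\<close>.\<close>
  define e where "e i = orbit_prod k x (\<lambda>j. q ^ (i * (d - j))) d" for i
  have e_N: "e i \<in> N" for i unfolding e_def by (rule orbit_prod_in_N[OF k x])
  have kd: "k [^] d \<otimes> x \<otimes> inv (k [^] d) = x" by (rule N_conj_N[OF pow_d_in_N[OF k] x])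
  \<comment> \<open>Shifting the coefficients of \<open>e i\<close> by one place multiplies them by \<open>q\<^sup>i\<close>; the term that leaves at
    the end of the orbit returns at its beginning, because \<open>k\<^sup>d\<close> commutes with \<open>x\<close>.\<close>
  have e_eigen: "k \<otimes> e i \<otimes> inv k = e i [^] (q ^ i)" for i
  proof -
    define c where "c j = (if j = 0 then 0 else q ^ (i * (d - (j - 1))))" for j
    define c0 where "c0 j = (if j = 0 then q ^ (i * d + i) else 0)" for j :: nat
    have "k \<otimes> e i \<otimes> inv k = orbit_prod k x c (Suc d)"
      unfolding orbit_prod_shift[OF k x] e_def using k N_carrier[OF orbit_prod_in_N[OF k x]]
      by (simp add: c_def)
    also have "\<dots> = orbit_prod k x c d \<otimes> x [^] c d" by (simp add: kd)
    also have "x [^] c d = x [^] q ^ i" using d_gt_1 by (simp add: c_def)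
    also have "\<dots> = x [^] q ^ (i * d + i)"
      by (rule N_pow_cong[OF x], rule iffD2[OF pow_q_cong_iff]) (simp add: cong_def)
    also have "\<dots> = orbit_prod k x c0 d"
      using orbit_prod_first[OF k x, of d c0] d_gt_1 by (simp add: c0_def)
    also have "orbit_prod k x c d \<otimes> orbit_prod k x c0 d = orbit_prod k x (\<lambda>j. c j + c0 j) d"
      by (rule orbit_prod_add[OF k x, symmetric])
    also have "\<dots> = orbit_prod k x (\<lambda>j. q ^ (i * (d - j)) * q ^ i) d"
    proof (rule orbit_prod_cong[OF k x])
      fix j assume j: "j < d"
      have "c j + c0 j = q ^ (i * (d - j)) * q ^ i"
      proof (cases j)
        case (Suc n)
        then have "d - n = Suc (d - j)" using j by simp
        with Suc show ?thesis by (simp add: c_def c0_def power_add)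
      qed (simp add: c_def c0_def power_add)
      then show "[c j + c0 j = q ^ (i * (d - j)) * q ^ i] (mod p)" by simp
    qed
    also have "\<dots> = e i [^] (q ^ i)" unfolding e_def by (rule orbit_prod_pow[OF k x, symmetric])
    finally show ?thesis .
  qed
  have "orbit_prod k x (\<lambda>j. \<Sum>i<s. q ^ (i * (d - j))) d \<in> S" if "s \<le> d" for s
    using that
  proof (induction s)
    case 0
    have "orbit_prod k x (\<lambda>_. 0) n = \<one>" for n by (induction n) simp_all
    then show ?case by (simp add: subgroup.one_closed[OF S])
  next
    case (Suc s)
    have "e s \<in> S" using eigen[OF _ e_N e_eigen] Suc.prems by simp
    with Suc show ?case
      by (simp add: orbit_prod_add[OF k x] subgroup.m_closed[OF S] flip: e_def)
  qed
  then have "orbit_prod k x (\<lambda>j. \<Sum>i<d. q ^ (i * (d - j))) d \<in> S" by blast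
  \<comment> \<open>All coefficients of the sum of the \<open>e i\<close> except the first vanish modulo \<open>p\<close>.\<close>
  also have "orbit_prod k x (\<lambda>j. \<Sum>i<d. q ^ (i * (d - j))) d = x [^] (\<Sum>i<d. q ^ (i * d))"
    using orbit_prod_first[OF k x, of d "\<lambda>j. \<Sum>i<d. q ^ (i * (d - j))"] dvd_geometric_sum d_gt_1
    by simp
  also have "x [^] (\<Sum>i<d. q ^ (i * d)) = x [^] d"
  proof (rule N_pow_cong[OF x])
    have "[q ^ (i * d) = q ^ 0] (mod p)" for i unfolding pow_q_cong_iff by (simp add: cong_def)
    then have "[(\<Sum>i<d. q ^ (i * d)) = (\<Sum>i<d. q ^ 0)] (mod p)" by (intro cong_sum)
    then show "[(\<Sum>i<d. q ^ (i * d)) = d] (mod p)" by simp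
  qed
  finally show "y \<in> S" unfolding y .
qed

end


section \<open>Homomorphisms from monolithic groups to the affine group\<close>

context metab_group begin

text \<open>
  The eigenspaces of \<open>k\<close> in \<open>N\<close> are normal subgroups with pairwise trivial intersections. In a
  monolithic group only one of them can be nontrivial, so it is all of \<open>N\<close>.
\<close>

lemma acts_by_scalars:
  assumes g: "monolith_element G g" and nontriv: "N \<noteq> {\<one>}" and k: "k \<in> carrier G"
  shows "\<exists>i<d. \<forall>x\<in>N. k \<otimes> x \<otimes> inv k = x [^] (q ^ i)"
proof -
  define E where "E i = {x \<in> N. k \<otimes> x \<otimes> inv k = x [^] (q ^ i)}" for i
  have subgr: "subgroup (E i) G" for i
  proof (rule subgroupI)
    show "E i \<subseteq> carrier G" using N_carrier by (auto simp: E_def)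
    have "\<one> \<in> E i" using k subgroup.one_closed[OF subgroup_N] by (simp add: E_def)
    then show "E i \<noteq> {}" by blast
  next
    fix x assume "x \<in> E i"
    then have x: "x \<in> N" "k \<otimes> x \<otimes> inv k = x [^] (q ^ i)" by (auto simp: E_def)
    have "k \<otimes> inv x \<otimes> inv k = inv (k \<otimes> x \<otimes> inv k)"
      using k N_carrier[OF x(1)] by (simp add: inv_mult_group m_assoc)
    also have "\<dots> = inv x [^] (q ^ i)" unfolding x(2) by (rule nat_pow_inv[symmetric, OF N_carrier[OF x(1)]])
    finally show "inv x \<in> E i" using subgroup.m_inv_closed[OF subgroup_N x(1)] by (simp add: E_def)
  next
    fix x y assume "x \<in> E i" "y \<in> E i"
    then have x: "x \<in> N" "k \<otimes> x \<otimes> inv k = x [^] (q ^ i)"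
      and y: "y \<in> N" "k \<otimes> y \<otimes> inv k = y [^] (q ^ i)" by (auto simp: E_def)
    have "k \<otimes> (x \<otimes> y) \<otimes> inv k = (x \<otimes> y) [^] (q ^ i)"
      unfolding conj_mult[OF k N_carrier[OF x(1)] N_carrier[OF y(1)]] x(2) y(2)
      by (rule N_pow_mult[symmetric, OF x(1) y(1)])
    then show "x \<otimes> y \<in> E i" using N_mult_closed[OF x(1) y(1)] by (simp add: E_def)
  qed
  have norm: "E i \<lhd> G" for i
    unfolding normal_inv_iff
  proof (intro conjI ballI subgr)
    fix h x assume h: "h \<in> carrier G" and "x \<in> E i"
    then have x: "x \<in> N" "k \<otimes> x \<otimes> inv k = x [^] (q ^ i)" by (auto simp: E_def)
    have "k \<otimes> (h \<otimes> x \<otimes> inv h) \<otimes> inv k = (h \<otimes> x \<otimes> inv h) [^] (q ^ i)"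
      unfolding conj_comm[OF k h x(1)] x(2) by (rule conj_pow[symmetric, OF h N_carrier[OF x(1)]])
    then show "h \<otimes> x \<otimes> inv h \<in> E i" using conj_N[OF h x(1)] by (simp add: E_def)
  qed
  have gE: "g \<in> E i" if "E i \<noteq> {\<one>}" for i
    using g norm[of i] that unfolding monolith_element_def by blast
  have one_E: "\<one> \<in> E i" for i by (rule subgroup.one_closed[OF subgr])
  obtain i where i: "i < d" "E i \<noteq> {\<one>}"
  proof -
    have "\<exists>i<d. E i \<noteq> {\<one>}"
    proof (rule ccontr)
      assume "\<not> (\<exists>i<d. E i \<noteq> {\<one>})"
      then have "N \<subseteq> {\<one>}"
        by (intro eigenspaces_span[OF k triv_subgroup]) (auto simp: E_def)
      with nontriv subgroup.one_closed[OF subgroup_N] show False by blast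
    qed
    with that show ?thesis by blast
  qed
  have "N \<subseteq> E i"
  proof (rule eigenspaces_span[OF k subgr])
    fix j x assume j: "j < d" and x: "x \<in> N" "k \<otimes> x \<otimes> inv k = x [^] (q ^ j)"
    then have xE: "x \<in> E j" by (simp add: E_def)
    show "x \<in> E i"
    proof (cases "E j = {\<one>}")
      case True
      with xE one_E show ?thesis by simp
    next
      case False
      then have "g \<in> E j" "g \<in> E i" using gE i(2) by blast+
      then have "g \<in> N" "g [^] (q ^ i) = g [^] (q ^ j)" unfolding E_def by auto
      moreover have "g \<noteq> \<one>" using g by (simp add: monolith_element_def)
      ultimately have "[q ^ i = q ^ j] (mod p)" by (simp add: N_pow_eq_iff)
      then have "[i = j] (mod d)" by (simp only: pow_q_cong_iff)
      then have "i = j" using i(1) j by (simp add: cong_def)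
      with xE show ?thesis by simp
    qed
  qed
  then show ?thesis using i(1) unfolding E_def by blast
qed

text \<open>
  Since \<open>G\<close> acts on \<open>N\<close> by scalars, every cyclic subgroup of \<open>N\<close> is normal and so contains \<open>g\<close>
  if it is nontrivial. A group of exponent \<open>p\<close> with this property is cyclic of order \<open>p\<close>.
\<close>

lemma N_powers_of_monolith:
  assumes fin: "finite (carrier G)" and g: "monolith_element G g" and nontriv: "N \<noteq> {\<one>}"
  shows "g \<in> N" and "x \<in> N \<Longrightarrow> \<exists>j::nat. x = g [^] j"
proof -
  show gN: "g \<in> N" using g normal_N nontriv unfolding monolith_element_def by blast
  have g1: "g \<noteq> \<one>" using g by (simp add: monolith_element_def)
  show "\<exists>j::nat. x = g [^] j" if x: "x \<in> N"
  proof (cases "x = \<one>")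
    case True
    then show ?thesis by (intro exI[of _ 0]) simp
  next
    case False
    note xc = N_carrier[OF x]
    have sub: "subgroup (generate G {x}) G" using xc by (intro generate_is_subgroup) simp
    have "generate G {x} \<lhd> G"
      unfolding normal_inv_iff
    proof (intro conjI ballI sub)
      fix k y assume k: "k \<in> carrier G" and "y \<in> generate G {x}"
      then obtain j :: nat where y: "y = x [^] j" using mem_generate_iff[OF fin xc] by blast
      obtain i where i: "k \<otimes> x \<otimes> inv k = x [^] (q ^ i)"
        using acts_by_scalars[OF g nontriv k] x by blast
      have "k \<otimes> y \<otimes> inv k = (k \<otimes> x \<otimes> inv k) [^] j" unfolding y by (rule conj_pow[symmetric, OF k xc])
      also have "\<dots> = x [^] (q ^ i * j)" unfolding i by (rule nat_pow_pow[OF xc])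
      finally show "k \<otimes> y \<otimes> inv k \<in> generate G {x}" using mem_generate_iff[OF fin xc] by blast
    qed
    moreover have "x \<in> generate G {x}" by (rule generate.incl) simp
    ultimately have "g \<in> generate G {x}" using g False unfolding monolith_element_def by blast
    then obtain j :: nat where j: "g = x [^] j" using mem_generate_iff[OF fin xc] by blast
    have "\<not> p dvd j"
    proof
      assume "p dvd j"
      then have "[j = 0] (mod p)" by (simp add: cong_0_iff)
      from N_pow_cong[OF x this] j g1 show False by simp
    qed
    then have "coprime j p" using prime_p by (metis coprime_commute prime_imp_coprime)
    then obtain s where s: "[j * s = 1] (mod p)" using cong_solve_coprime_nat[of j p] by auto
    have "g [^] s = x [^] (j * s)" unfolding j by (rule nat_pow_pow[OF xc])
    also have "\<dots> = x [^] (1::nat)" by (rule N_pow_cong[OF x s])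
    finally have "x = g [^] s" using xc by simp
    then show ?thesis by blast
  qed
qed

lemma commutator_mult:
  assumes k: "k \<in> carrier G" and h: "h \<in> carrier G" and t: "t \<in> carrier G"
  shows "(k \<otimes> h) \<otimes> t \<otimes> inv (k \<otimes> h) \<otimes> inv t
    = (k \<otimes> t \<otimes> inv k \<otimes> inv t) \<otimes> (k \<otimes> (h \<otimes> t \<otimes> inv h \<otimes> inv t) \<otimes> inv k)"
proof -
  have "(k \<otimes> h) \<otimes> t \<otimes> inv (k \<otimes> h) \<otimes> inv t
    = (k \<otimes> (h \<otimes> t \<otimes> inv h \<otimes> inv t) \<otimes> inv k) \<otimes> (k \<otimes> t \<otimes> inv k \<otimes> inv t)"
  proof -
    have "inv k \<otimes> (k \<otimes> z) = z" "inv t \<otimes> (t \<otimes> z) = z" if "z \<in> carrier G" for z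
      using k t that by (simp_all flip: m_assoc)
    then show ?thesis using assms by (simp add: m_assoc inv_mult_group)
  qed
  also have "\<dots> = (k \<otimes> t \<otimes> inv k \<otimes> inv t) \<otimes> (k \<otimes> (h \<otimes> t \<otimes> inv h \<otimes> inv t) \<otimes> inv k)"
    by (rule N_commute) (use assms in \<open>auto intro!: conj_N commutator_in_N\<close>)
  finally show ?thesis .
qed

text \<open>
  The map \<open>k \<mapsto> [k, t]\<close> is a cocycle with values in \<open>N\<close>, by \<open>commutator_mult\<close>. Reading it in
  exponents of \<open>g\<close> gives the translation part, and the scalar by which \<open>k\<close> acts gives the linear
  part, of an affine map. This avoids choosing a complement of \<open>N\<close>. The translation part of \<open>g\<close>
  is not zero because \<open>g\<close> and \<open>t\<close> do not commute.
\<close>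

lemma hom_affine_of_noncentral:
  assumes fin: "finite (carrier G)" and g: "monolith_element G g" and nontriv: "N \<noteq> {\<one>}"
    and t: "t \<in> carrier G" "g \<otimes> t \<noteq> t \<otimes> g"
  shows "\<exists>\<theta>\<in>hom G affine_group. \<theta> g \<noteq> \<one>\<^bsub>affine_group\<^esub>"
proof -
  have gN: "g \<in> N" and powers: "\<And>x. x \<in> N \<Longrightarrow> \<exists>j::nat. x = g [^] j"
    using N_powers_of_monolith[OF fin g nontriv] by blast+
  have g1: "g \<noteq> \<one>" using g by (simp add: monolith_element_def)
  note gc = N_carrier[OF gN]
  have "\<exists>i<d. k \<otimes> g \<otimes> inv k = g [^] (q ^ i)" if "k \<in> carrier G" for k
    using acts_by_scalars[OF g nontriv that] gN by blast
  then obtain \<chi> where \<chi>: "\<And>k. k \<in> carrier G \<Longrightarrow> \<chi> k < d"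
      "\<And>k. k \<in> carrier G \<Longrightarrow> k \<otimes> g \<otimes> inv k = g [^] (q ^ \<chi> k)"
    by metis
  have "\<exists>j. j < p \<and> k \<otimes> t \<otimes> inv k \<otimes> inv t = g [^] j" if k: "k \<in> carrier G" for k
  proof -
    obtain j :: nat where "k \<otimes> t \<otimes> inv k \<otimes> inv t = g [^] j"
      using powers[OF commutator_in_N[OF k t(1)]] by blast
    also have "\<dots> = g [^] (j mod p)" by (rule N_pow_cong[OF gN]) (simp add: cong_def)
    finally show ?thesis using p_gt_1 by (intro exI[of _ "j mod p"]) simp
  qed
  then obtain c where c: "\<And>k. k \<in> carrier G \<Longrightarrow> c k < p"
      "\<And>k. k \<in> carrier G \<Longrightarrow> k \<otimes> t \<otimes> inv k \<otimes> inv t = g [^] c k"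
    by metis
  have "(\<lambda>k. (c k, \<chi> k)) \<in> hom G affine_group"
  proof (rule homI)
    fix k assume "k \<in> carrier G"
    then show "(c k, \<chi> k) \<in> carrier affine_group" using c(1) \<chi>(1) by simp
  next
    fix k h assume k: "k \<in> carrier G" and h: "h \<in> carrier G"
    then have kh: "k \<otimes> h \<in> carrier G" by simp
    have "g [^] (q ^ \<chi> (k \<otimes> h)) = k \<otimes> (h \<otimes> g \<otimes> inv h) \<otimes> inv k"
      unfolding conj_conj[OF k h gc] by (rule \<chi>(2)[OF kh, symmetric])
    also have "\<dots> = (k \<otimes> g \<otimes> inv k) [^] (q ^ \<chi> h)"
      unfolding \<chi>(2)[OF h] by (rule conj_pow[OF k gc, symmetric])
    also have "\<dots> = g [^] (q ^ (\<chi> k + \<chi> h))"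
      unfolding \<chi>(2)[OF k] power_add by (rule nat_pow_pow[OF gc])
    finally have "[q ^ \<chi> (k \<otimes> h) = q ^ (\<chi> k + \<chi> h)] (mod p)"
      by (simp only: N_pow_eq_iff[OF gN g1])
    then have "[\<chi> (k \<otimes> h) = \<chi> k + \<chi> h] (mod d)" by (simp only: pow_q_cong_iff)
    then have 1: "\<chi> (k \<otimes> h) = (\<chi> k + \<chi> h) mod d" using \<chi>(1)[OF kh] by (simp add: cong_def)
    have "g [^] c (k \<otimes> h) = g [^] c k \<otimes> (k \<otimes> g [^] c h \<otimes> inv k)"
      using commutator_mult[OF k h t(1)] unfolding c(2)[OF kh] c(2)[OF k] c(2)[OF h] .
    also have "k \<otimes> g [^] c h \<otimes> inv k = (k \<otimes> g \<otimes> inv k) [^] c h"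
      by (rule conj_pow[OF k gc, symmetric])
    also have "\<dots> = g [^] (q ^ \<chi> k * c h)" unfolding \<chi>(2)[OF k] by (rule nat_pow_pow[OF gc])
    also have "g [^] c k \<otimes> \<dots> = g [^] (c k + q ^ \<chi> k * c h)" by (rule nat_pow_mult[OF gc])
    finally have "[c (k \<otimes> h) = c k + q ^ \<chi> k * c h] (mod p)" by (simp only: N_pow_eq_iff[OF gN g1])
    then have 2: "c (k \<otimes> h) = (c k + q ^ \<chi> k * c h) mod p" using c(1)[OF kh] by (simp add: cong_def)
    show "(c (k \<otimes> h), \<chi> (k \<otimes> h)) = (c k, \<chi> k) \<otimes>\<^bsub>affine_group\<^esub> (c h, \<chi> h)" by (simp add: 1 2)
  qed
  moreover have "c g \<noteq> 0"
  proof
    assume "c g = 0"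
    then have "g \<otimes> t \<otimes> inv g \<otimes> inv t = \<one>" using c(2)[OF gc] by simp
    with t gc show False by (simp add: commutator_eq_one_iff)
  qed
  ultimately show ?thesis by (intro bexI[of _ "\<lambda>k. (c k, \<chi> k)"]) simp_all
qed

text \<open>
  If \<open>g\<close> is central, so is \<open>N\<close>. Then the elements killed by \<open>d\<close> commute with each other and form
  a normal subgroup that meets \<open>N\<close> trivially. As \<open>g\<close> is not in it, it is trivial, so \<open>G\<close> is equal
  to \<open>N\<close> and consists of the translations.
\<close>

lemma hom_affine_of_central:
  assumes fin: "finite (carrier G)" and g: "monolith_element G g" and nontriv: "N \<noteq> {\<one>}"
    and central: "\<And>t. t \<in> carrier G \<Longrightarrow> g \<otimes> t = t \<otimes> g"
  shows "\<exists>\<theta>\<in>hom G affine_group. \<theta> g \<noteq> \<one>\<^bsub>affine_group\<^esub>"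
proof -
  have gN: "g \<in> N" and powers: "\<And>x. x \<in> N \<Longrightarrow> \<exists>j::nat. x = g [^] j"
    using N_powers_of_monolith[OF fin g nontriv] by blast+
  have g1: "g \<noteq> \<one>" using g by (simp add: monolith_element_def)
  note gc = N_carrier[OF gN]
  have N_central: "c \<otimes> y = y \<otimes> c" if c: "c \<in> N" and y: "y \<in> carrier G" for c y
  proof -
    obtain j :: nat where "c = g [^] j" using powers[OF c] by blast
    then show ?thesis using group_commutes_pow[OF central[OF y] gc y] by simp
  qed
  define D where "D = {x \<in> carrier G. x [^] d = \<one>}"
  \<comment> \<open>The commutator \<open>c\<close> of \<open>x\<close> and \<open>y\<close> is central and \<open>c y\<close> is conjugate to \<open>y\<close>, so \<open>c\<^sup>d = 1\<close>.\<close>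
  have D_comm: "x \<otimes> y = y \<otimes> x" if "x \<in> D" "y \<in> D" for x y
  proof -
    from that have x: "x \<in> carrier G" and y: "y \<in> carrier G" "y [^] d = \<one>" by (auto simp: D_def)
    let ?c = "x \<otimes> y \<otimes> inv x \<otimes> inv y"
    have c: "?c \<in> N" by (rule commutator_in_N[OF x y(1)])
    have "?c \<otimes> y = x \<otimes> y \<otimes> inv x" using x y by (simp add: m_assoc)
    then have "(?c \<otimes> y) [^] d = \<one>" using x y by (simp add: conj_pow)
    then have "?c [^] d = \<one>"
      using pow_mult_distrib[OF N_central[OF c y(1)] N_carrier[OF c] y(1), of d] y N_carrier[OF c] by simp
    then have "?c = \<one>" by (rule pow_d_eq_one[OF c])
    then show ?thesis using x y by (simp add: commutator_eq_one_iff)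
  qed
  have "subgroup D G"
  proof (rule subgroupI)
    show "D \<noteq> {}" by (auto simp: D_def intro!: exI[of _ \<one>])
  next
    fix x y assume xy: "x \<in> D" "y \<in> D"
    then have "x \<in> carrier G" "y \<in> carrier G" "x [^] d = \<one>" "y [^] d = \<one>" by (auto simp: D_def)
    then show "x \<otimes> y \<in> D" using pow_mult_distrib[OF D_comm[OF xy], of d] by (simp add: D_def)
  qed (auto simp: D_def nat_pow_inv)
  then have "D \<lhd> G" unfolding normal_inv_iff by (auto simp: D_def conj_pow)
  moreover have "g \<notin> D" using pow_d_eq_one[OF gN] g1 by (auto simp: D_def)
  ultimately have D: "D = {\<one>}" using g unfolding monolith_element_def by blast
  have GN: "x \<in> N" if x: "x \<in> carrier G" for x
  proof -
    have "(x [^] p) [^] d = \<one>" using pow_dp[OF x] x by (simp add: nat_pow_pow mult.commute)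
    then have "x [^] p \<in> D" using x by (simp add: D_def)
    then show ?thesis using D x by (simp add: N_def)
  qed
  have "\<exists>j. j < p \<and> k = g [^] j" if k: "k \<in> carrier G" for k
  proof -
    obtain j :: nat where "k = g [^] j" using powers[OF GN[OF k]] by blast
    also have "\<dots> = g [^] (j mod p)" by (rule N_pow_cong[OF gN]) (simp add: cong_def)
    finally show ?thesis using p_gt_1 by (intro exI[of _ "j mod p"]) simp
  qed
  then obtain c where c: "\<And>k. k \<in> carrier G \<Longrightarrow> c k < p" "\<And>k. k \<in> carrier G \<Longrightarrow> k = g [^] c k"
    by metis
  have "(\<lambda>k. (c k, 0)) \<in> hom G affine_group"
  proof (rule homI)
    fix k assume "k \<in> carrier G"
    then show "(c k, 0) \<in> carrier affine_group" using c(1) d_gt_1 by simp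
  next
    fix k h assume k: "k \<in> carrier G" and h: "h \<in> carrier G"
    then have kh: "k \<otimes> h \<in> carrier G" by simp
    have "g [^] c (k \<otimes> h) = g [^] c k \<otimes> g [^] c h"
      using c(2)[OF k, symmetric] c(2)[OF h, symmetric] c(2)[OF kh, symmetric] by (simp only:)
    also have "\<dots> = g [^] (c k + c h)" by (rule nat_pow_mult[OF gc])
    finally have "[c (k \<otimes> h) = c k + c h] (mod p)" by (simp only: N_pow_eq_iff[OF gN g1])
    then have "c (k \<otimes> h) = (c k + c h) mod p" using c(1)[OF kh] by (simp add: cong_def)
    then show "(c (k \<otimes> h), 0) = (c k, 0) \<otimes>\<^bsub>affine_group\<^esub> (c h, 0)" by simp
  qed
  moreover have "c g \<noteq> 0"
  proof
    assume "c g = 0"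
    then have "g = \<one>" using c(2)[OF gc] by simp
    with g1 show False by contradiction
  qed
  ultimately show ?thesis by (intro bexI[of _ "\<lambda>k. (c k, 0)"]) simp_all
qed

text \<open>
  Here \<open>G\<close> is abelian of exponent dividing \<open>d\<close>, hence cyclic of order dividing \<open>d\<close>, and it embeds in
  the rotations \<open>(0, j)\<close>.
\<close>

lemma hom_affine_of_trivial_N:
  assumes fin: "finite (carrier G)" and g: "monolith_element G g" and triv: "N = {\<one>}"
  shows "\<exists>\<theta>\<in>hom G affine_group. \<theta> g \<noteq> \<one>\<^bsub>affine_group\<^esub>"
proof -
  have gc: "g \<in> carrier G" "g \<noteq> \<one>" using g by (auto simp: monolith_element_def)
  have "x \<otimes> y = y \<otimes> x" if "x \<in> carrier G" "y \<in> carrier G" for x y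
    using commutator_in_N[OF that] that by (simp add: triv commutator_eq_one_iff)
  then interpret comm_group G by (rule group_comm_groupI)
  obtain a where a: "a \<in> carrier G" and gen: "\<And>x. x \<in> carrier G \<Longrightarrow> \<exists>j::nat. x = a [^] j"
    using monolithic_imp_cyclic[OF fin g] by metis
  define e where "e = group.ord G a"
  have "a [^] d = \<one>" using pow_d_in_N[OF a] by (simp add: triv)
  then have "e dvd d" unfolding e_def using a by (simp add: pow_eq_id)
  then obtain m where d: "d = e * m" by (elim dvdE)
  have pow_iff: "a [^] (i::nat) = a [^] (j::nat) \<longleftrightarrow> [i = j] (mod e)" for i j
    unfolding e_def by (rule nat_pow_eq_iff[OF a])
  have m: "[i * m = j * m] (mod d) \<longleftrightarrow> [i = j] (mod e)" for i j
    using d d_gt_1 by (cases "m = 0") (auto simp: cong_def mod_mult_mult2)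
  obtain c where c: "\<And>x. x \<in> carrier G \<Longrightarrow> x = a [^] (c x :: nat)" using gen by metis
  have "(\<lambda>x. (0, c x * m mod d)) \<in> hom G affine_group"
  proof (rule homI)
    fix k assume "k \<in> carrier G"
    then show "(0, c k * m mod d) \<in> carrier affine_group" using p_gt_1 d_gt_1 by simp
  next
    fix k h assume k: "k \<in> carrier G" and h: "h \<in> carrier G"
    then have kh: "k \<otimes> h \<in> carrier G" by simp
    have "a [^] c (k \<otimes> h) = a [^] c k \<otimes> a [^] c h"
      using c[OF k, symmetric] c[OF h, symmetric] c[OF kh, symmetric] by (simp only:)
    also have "\<dots> = a [^] (c k + c h)" by (rule nat_pow_mult[OF a])
    finally have "[c (k \<otimes> h) * m = (c k + c h) * m] (mod d)" unfolding pow_iff m .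
    then have "c (k \<otimes> h) * m mod d = (c k * m mod d + c h * m mod d) mod d"
      by (simp add: cong_def mod_add_eq distrib_right)
    then show "(0, c (k \<otimes> h) * m mod d) = (0, c k * m mod d) \<otimes>\<^bsub>affine_group\<^esub> (0, c h * m mod d)"
      by simp
  qed
  moreover have "c g * m mod d \<noteq> 0"
  proof
    assume "c g * m mod d = 0"
    then have "[c g * m = 0 * m] (mod d)" by (simp add: cong_def)
    then have "a [^] c g = a [^] (0::nat)" unfolding m pow_iff .
    then have "g = \<one>" using c[OF gc(1)] by simp
    with gc(2) show False by contradiction
  qed
  ultimately show ?thesis by (intro bexI[of _ "\<lambda>x. (0, c x * m mod d)"]) simp_all
qed

lemma hom_affine_of_monolithic:
  assumes fin: "finite (carrier G)" and g: "monolith_element G g"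
  shows "\<exists>\<theta>\<in>hom G affine_group. \<theta> g \<noteq> \<one>\<^bsub>affine_group\<^esub>"
  using hom_affine_of_trivial_N[OF fin g] hom_affine_of_central[OF fin g]
    hom_affine_of_noncentral[OF fin g] by blast

end

context affine_params begin

text \<open>
  It suffices to separate a given element from the identity, which can be done after passing
  to a monolithic quotient.
\<close>

lemma in_pv_generated_affine:
  assumes K: "group K" "finite (carrier K)" and laws: "\<And>l. l \<in> metab_laws p d \<Longrightarrow> satisfies K l"
  shows "K \<in> pv_generated affine_group"
proof (rule pv_generated_residual[OF group_affine K])
  fix g assume g: "g \<in> carrier K" "g \<noteq> \<one>\<^bsub>K\<^esub>"
  interpret group K by fact
  obtain M where M: "M \<lhd> K" "monolith_element (K Mod M) (M #>\<^bsub>K\<^esub> g)"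
    using ex_monolithic_quotient[OF K(2) g] by blast
  interpret M: normal M K by (rule M(1))
  let ?\<pi> = "\<lambda>x. M #>\<^bsub>K\<^esub> x"
  have \<pi>: "?\<pi> \<in> epi K (K Mod M)" using M.r_coset_hom_Mod by (simp add: epi_def carrier_FactGroup)
  have fin: "finite (carrier (K Mod M))" using K(2) by (simp add: carrier_FactGroup)
  interpret Q: group "K Mod M" by (rule M.factorgroup_is_group)
  interpret Q: metab_group p d q "K Mod M"
    by unfold_locales (rule satisfies_epi[OF is_group Q.is_group \<pi> laws])
  obtain \<theta> where \<theta>: "\<theta> \<in> hom (K Mod M) affine_group" "\<theta> (M #>\<^bsub>K\<^esub> g) \<noteq> \<one>\<^bsub>affine_group\<^esub>"
    using Q.hom_affine_of_monolithic[OF fin M(2)] by blast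
  have "\<theta> \<circ> ?\<pi> \<in> hom K affine_group" by (rule Group.hom_compose[OF M.r_coset_hom_Mod \<theta>(1)])
  moreover have "(\<theta> \<circ> ?\<pi>) g \<noteq> \<one>\<^bsub>affine_group\<^esub>" using \<theta>(2) by simp
  ultimately show "\<exists>\<phi>\<in>hom K affine_group. \<phi> g \<noteq> \<one>\<^bsub>affine_group\<^esub>" by blast
qed

lemma pv_product_eq_pv_generated_affine: "Ab p \<^bold>* Ab d = pv_generated affine_group"
proof (intro equalityI subsetI)
  fix K assume "K \<in> Ab p \<^bold>* Ab d"
  then show "K \<in> pv_generated affine_group"
    unfolding pv_product_Ab_metab_laws by (auto intro: in_pv_generated_affine)
next
  fix K assume K: "K \<in> pv_generated affine_group"
  have "finite (carrier affine_group)" by simp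
  from pv_generated_finite[OF group_affine this K] K
  show "K \<in> Ab p \<^bold>* Ab d"
    unfolding pv_product_Ab_metab_laws
    using satisfies_pv_generated[OF group_affine affine_metab_laws K] by (simp add: pv_generated_def)
qed

end


section \<open>Generators of minimal order\<close>

context affine_params begin

lemma affine_power_law:
  assumes "satisfies affine_group (power_law k)"
  shows "p dvd k" "d dvd k"
proof -
  have "\<forall>x\<in>carrier affine_group. x [^]\<^bsub>affine_group\<^esub> k = \<one>\<^bsub>affine_group\<^esub>"
    using assms group.satisfies_power_law[OF group_affine] by blast
  moreover have "(1, 0) \<in> carrier affine_group" "(0, 1) \<in> carrier affine_group"
    using p_gt_1 d_gt_1 by auto
  ultimately have "(1, 0) [^]\<^bsub>affine_group\<^esub> k = (0, 0)" "(0, 1) [^]\<^bsub>affine_group\<^esub> k = (0, 0)"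
    unfolding affine_simps(3) by blast+
  then show "p dvd k" "d dvd k"
    by (simp_all add: affine_translation_pow affine_rotation_pow mod_eq_0_iff_dvd)
qed

text \<open>
  A rotation commutes with the translation by \<open>d\<close>, which is nonzero modulo \<open>p\<close>, only if it is
  trivial; this is applied to the \<open>m\<close>-th power of the generating rotation.
\<close>

lemma affine_powers_commute_law:
  assumes "satisfies affine_group (powers_commute_law m d)"
  shows "d dvd m"
proof -
  let ?r = "(0, m mod d)" and ?t = "(d, 0)"
  have "\<forall>x\<in>carrier affine_group. \<forall>y\<in>carrier affine_group.
      x [^]\<^bsub>affine_group\<^esub> m \<otimes>\<^bsub>affine_group\<^esub> y [^]\<^bsub>affine_group\<^esub> d =
      y [^]\<^bsub>affine_group\<^esub> d \<otimes>\<^bsub>affine_group\<^esub> x [^]\<^bsub>affine_group\<^esub> m"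
    using assms group.satisfies_powers_commute_law[OF group_affine] by blast
  moreover have "(1, 0) \<in> carrier affine_group" "(0, 1) \<in> carrier affine_group"
    using p_gt_1 d_gt_1 by auto
  ultimately have "(0, 1) [^]\<^bsub>affine_group\<^esub> m \<otimes>\<^bsub>affine_group\<^esub> (1, 0) [^]\<^bsub>affine_group\<^esub> d =
      (1, 0) [^]\<^bsub>affine_group\<^esub> d \<otimes>\<^bsub>affine_group\<^esub> (0, 1) [^]\<^bsub>affine_group\<^esub> m"
    by blast
  then have "[q ^ (m mod d) * d = 1 * d] (mod p)"
    using d_less_p by (simp add: affine_translation_pow affine_rotation_pow cong_def)
  then have "[q ^ (m mod d) = q ^ 0] (mod p)"
    using cong_mult_rcancel_nat[of d p "q ^ (m mod d)" 1] coprime_p_d by (simp add: coprime_commute)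
  then have "[m mod d = 0] (mod d)" unfolding pow_q_cong_iff .
  then show ?thesis by (simp add: cong_def mod_eq_0_iff_dvd)
qed

end

context metab_group begin

lemma order_eq_card_N_times_index: "order G = card N * card (rcosets N)"
  using lagrange[OF subgroup_N] by (simp add: mult.commute)

lemma N_pow_card:
  assumes "finite (carrier G)" "x \<in> N"
  shows "x [^] card N = \<one>"
proof -
  interpret A: group "G\<lparr>carrier := N\<rparr>" using subgroup_N is_group by (rule subgroup.subgroup_is_group)
  have "x [^]\<^bsub>G\<lparr>carrier := N\<rparr>\<^esub> order (G\<lparr>carrier := N\<rparr>) = \<one>\<^bsub>G\<lparr>carrier := N\<rparr>\<^esub>"
    using assms(2) by (intro A.pow_order_eq_1) simp
  then show ?thesis unfolding nat_pow_consistent[symmetric] by (simp add: order_def)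
qed

lemma pow_index_in_N:
  assumes "finite (carrier G)" "x \<in> carrier G"
  shows "x [^] card (rcosets N) \<in> N"
proof -
  interpret N: normal N G by (rule normal_N)
  interpret Q: group "G Mod N" by (rule N.factorgroup_is_group)
  have "N #> x \<in> carrier (G Mod N)" using assms by (auto simp: carrier_FactGroup)
  then have "(N #> x) [^]\<^bsub>G Mod N\<^esub> order (G Mod N) = \<one>\<^bsub>G Mod N\<^esub>" by (rule Q.pow_order_eq_1)
  then have "N #> (x [^] card (rcosets N)) = N"
    using N.FactGroup_pow[OF assms(2)] by (simp add: order_def FactGroup_def)
  then show ?thesis using assms(2) by (simp add: rcos_eq_self_iff[OF subgroup_N])
qed

end

text \<open>
  Every generator of the pseudovariety has this property, since the affine group belongs to the
  pseudovariety. All information on generators used below is extracted from a few laws.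
\<close>

locale generating_metab_group = metab_group +
  assumes fin: "finite (carrier G)"
    and laws_hold_in_affine: "\<And>l :: gens word \<times> gens word. satisfies G l \<Longrightarrow> satisfies affine_group l"

context generating_metab_group begin

text \<open>
  The exponent of \<open>N\<close> divides its order, so \<open>x ^ (d * card N) = 1\<close> is a law of \<open>G\<close>, hence of the
  affine group, which has an element of order \<open>p\<close>.
\<close>

lemma p_dvd_card_N: "p dvd card N"
proof -
  have "satisfies G (power_law (d * card N))"
    unfolding satisfies_power_law
    using N_pow_card[OF fin pow_d_in_N] by (simp add: nat_pow_pow)
  then have "p dvd d * card N" by (intro affine_power_law laws_hold_in_affine)
  then show ?thesis using coprime_p_d by (simp add: coprime_dvd_mult_right_iff)
qed

text \<open>
  Similarly, with \<open>m\<close> the index of \<open>N\<close>, the law \<open>x ^ (m * p) = 1\<close> passes to the affine group, which has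
  an element of order \<open>d\<close>.
\<close>

lemma d_dvd_index: "d dvd card (rcosets N)"
proof -
  have "x [^] (card (rcosets N) * p) = \<one>" if "x \<in> carrier G" for x
    using pow_index_in_N[OF fin that] that by (simp add: N_def nat_pow_pow)
  then have "satisfies G (power_law (card (rcosets N) * p))"
    unfolding satisfies_power_law by blast
  then have "d dvd card (rcosets N) * p" by (intro affine_power_law laws_hold_in_affine)
  then show ?thesis using coprime_p_d by (simp add: coprime_dvd_mult_left_iff coprime_commute)
qed

lemma order_pos: "order G > 0"
  using fin by (simp add: order_gt_0_iff_finite)

lemma order_ge: "p * d \<le> order G"
proof -
  have "p * d dvd order G"
    unfolding order_eq_card_N_times_index by (rule mult_dvd_mono[OF p_dvd_card_N d_dvd_index])
  then show ?thesis using order_pos by (rule dvd_imp_le)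
qed

text \<open>
  Now \<open>N\<close> has order \<open>p\<close>, so it is generated by some \<open>n\<close> and \<open>G\<close> acts on it by powers of \<open>q\<close>. Let
  \<open>q\<^sup>s\<close> generate the group of all scalars that occur, with \<open>s\<close> a divisor of \<open>d\<close>. Then \<open>(d / s)\<close>-th powers act
  trivially on \<open>N\<close>, so they commute with \<open>d\<close>-th powers. This law passes to the affine group
  and forces \<open>s = 1\<close>. An element acting as \<open>q\<close> can be corrected to one of order dividing \<open>d\<close>,
  which together with \<open>n\<close> satisfies the relations of the presentation.
\<close>

lemma iso_affine_of_order:
  assumes ord: "order G = p * d"
  shows "affine_group \<cong> G"
proof -
  \<comment> \<open>Both divisibilities must be equalities.\<close>
  obtain a b where a: "card N = p * a" and b: "card (rcosets N) = d * b"
    using p_dvd_card_N d_dvd_index by (elim dvdE)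
  have "p * d * (a * b) = p * d * 1" using ord unfolding order_eq_card_N_times_index a b by simp
  then have "a * b = 1" using p_gt_1 d_gt_1 by (simp only: mult_cancel1) simp
  then have cardN: "card N = p" using a by simp
  have finN: "finite N" by (rule finite_subset[OF _ fin]) (rule subsetI, rule N_carrier)
  have powers: "\<exists>j::nat. y = x [^] j" if x: "x \<in> N" "x \<noteq> \<one>" and y: "y \<in> N" for x y
  proof -
    have "inj_on (\<lambda>j. x [^] j) {..<p}"
      by (rule inj_onI) (simp add: N_pow_eq_iff[OF x] cong_def)
    then have "card ((\<lambda>j. x [^] j) ` {..<p}) = card N" by (simp add: card_image cardN)
    moreover have "(\<lambda>j. x [^] j) ` {..<p} \<subseteq> N" using N_pow_closed[OF x(1)] by blast
    ultimately have "(\<lambda>j. x [^] j) ` {..<p} = N" by (intro card_subset_eq[OF finN])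
    with y show ?thesis by blast
  qed
  obtain n where n: "n \<in> N" "n \<noteq> \<one>"
  proof -
    have "\<not> N \<subseteq> {\<one>}"
    proof
      assume "N \<subseteq> {\<one>}"
      then have "card N \<le> card {\<one>}" by (intro card_mono) simp_all
      with cardN p_gt_1 show False by simp
    qed
    with that show ?thesis by blast
  qed
  note nc = N_carrier[OF n(1)]
  have scalar: "\<exists>i. h \<otimes> n \<otimes> inv h = n [^] (q ^ i)" if h: "h \<in> carrier G" for h
  proof -
    have "\<exists>i x. x \<in> N \<and> x \<noteq> \<one> \<and> h \<otimes> x \<otimes> inv h = x [^] (q ^ i)"
    proof (rule ccontr)
      assume "\<not> ?thesis"
      then have "N \<subseteq> {\<one>}" by (intro eigenspaces_span[OF h triv_subgroup]) blast
      with n show False by blast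
    qed
    then obtain i x where x: "x \<in> N" "x \<noteq> \<one>" "h \<otimes> x \<otimes> inv h = x [^] (q ^ i)" by blast
    obtain j :: nat where j: "n = x [^] j" using powers[OF x(1,2) n(1)] by blast
    have "h \<otimes> n \<otimes> inv h = (h \<otimes> x \<otimes> inv h) [^] j" unfolding j by (rule conj_pow[OF h N_carrier[OF x(1)], symmetric])
    also have "\<dots> = n [^] (q ^ i)" unfolding x(3) j using N_carrier[OF x(1)] by (simp add: nat_pow_pow mult.commute)
    finally show ?thesis by blast
  qed
  define I where "I = {i. \<exists>h\<in>carrier G. h \<otimes> n \<otimes> inv h = n [^] (q ^ i)}"
  have pow_d_one: "n [^] (q ^ (d * i)) = n" for i
  proof -
    have "[q ^ (d * i) = q ^ 0] (mod p)" unfolding pow_q_cong_iff by (simp add: cong_def)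
    from N_pow_cong[OF n(1) this] show ?thesis using nc by simp
  qed
  have "d \<in> I" unfolding I_def using pow_d_one[of 1] nc by (intro CollectI bexI[of _ \<one>]) simp_all
  then have ex: "0 < d \<and> d \<in> I" using d_gt_1 by simp
  define s where "s = (LEAST i. 0 < i \<and> i \<in> I)"
  have s: "0 < s" "s \<in> I" using LeastI[of "\<lambda>i. 0 < i \<and> i \<in> I", OF ex] by (simp_all add: s_def)
  have least: "i = 0" if "i < s" "i \<in> I" for i
    using not_less_Least[of i "\<lambda>i. 0 < i \<and> i \<in> I"] that by (auto simp: s_def)
  obtain k where k: "k \<in> carrier G" "k \<otimes> n \<otimes> inv k = n [^] (q ^ s)" using s(2) by (auto simp: I_def)
  \<comment> \<open>If \<open>k\<close> acts as \<open>q\<^sup>s\<close> and \<open>h\<close> as \<open>q\<^sup>i\<close>, a negative power of \<open>k\<close> times \<open>h\<close> acts as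
    \<open>q\<close> to the remainder of \<open>i\<close> modulo \<open>s\<close>.\<close>
  have s_dvd: "s dvd i" if "i \<in> I" for i
  proof -
    from that obtain h where h: "h \<in> carrier G" "h \<otimes> n \<otimes> inv h = n [^] (q ^ i)" by (auto simp: I_def)
    define m where "m = i div s"
    define r where "r = i mod s"
    have i: "i = s * m + r" by (simp add: m_def r_def)
    let ?k = "k [^] m"
    have kc: "?k \<in> carrier G" using k by simp
    have "?k \<otimes> n [^] (q ^ r) \<otimes> inv ?k = (?k \<otimes> n \<otimes> inv ?k) [^] (q ^ r)"
      by (rule conj_pow[OF kc nc, symmetric])
    also have "\<dots> = n [^] (q ^ i)"
      unfolding conj_iterate[OF k(1) nc k(2)] i using nc by (simp add: nat_pow_pow power_add power_mult)
    finally have "?k \<otimes> n [^] (q ^ r) \<otimes> inv ?k = h \<otimes> n \<otimes> inv h" unfolding h(2) .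
    then have "inv ?k \<otimes> (?k \<otimes> n [^] (q ^ r) \<otimes> inv ?k) \<otimes> ?k = inv ?k \<otimes> (h \<otimes> n \<otimes> inv h) \<otimes> ?k" by simp
    also have "inv ?k \<otimes> (?k \<otimes> n [^] (q ^ r) \<otimes> inv ?k) \<otimes> ?k = n [^] (q ^ r)"
    proof -
      have "inv ?k \<otimes> (?k \<otimes> z) = z" if "z \<in> carrier G" for z
        using kc that by (simp flip: m_assoc)
      then show ?thesis using kc nc by (simp add: m_assoc)
    qed
    also have "inv ?k \<otimes> (h \<otimes> n \<otimes> inv h) \<otimes> ?k = (inv ?k \<otimes> h) \<otimes> n \<otimes> inv (inv ?k \<otimes> h)"
      using conj_conj[OF inv_closed[OF kc] h(1) nc] kc by simp
    finally have "r \<in> I" unfolding I_def using kc h(1) by (intro CollectI bexI[of _ "inv ?k \<otimes> h"]) simp_all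
    then have "r = 0" using s(1) by (intro least) (simp_all add: r_def)
    then show ?thesis by (simp add: i)
  qed
  have "s dvd d" using s_dvd ex by blast
  then obtain m where m: "d = s * m" by (elim dvdE)
  have "satisfies G (powers_commute_law m d)"
    unfolding satisfies_powers_commute_law
  proof (intro ballI)
    fix x y assume x: "x \<in> carrier G" and y: "y \<in> carrier G"
    obtain i where i: "x \<otimes> n \<otimes> inv x = n [^] (q ^ i)" using scalar[OF x] by blast
    then have "i \<in> I" using x by (auto simp: I_def)
    from s_dvd[OF this] obtain t where t: "i = s * t" by (elim dvdE)
    have "x [^] m \<otimes> n \<otimes> inv (x [^] m) = n [^] ((q ^ i) ^ m)" by (rule conj_iterate[OF x nc i])
    also have "(q ^ i) ^ m = q ^ (d * t)" by (simp add: m t mult.commute mult.left_commute flip: power_mult)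
    also have "n [^] (q ^ (d * t)) = n" by (rule pow_d_one)
    finally have xn: "n \<otimes> x [^] m = x [^] m \<otimes> n" using x nc by (simp add: conj_eq_iff_commute)
    obtain j :: nat where "y [^] d = n [^] j" using powers[OF n pow_d_in_N[OF y]] by blast
    then show "x [^] m \<otimes> y [^] d = y [^] d \<otimes> x [^] m"
      using group_commutes_pow[OF xn nc nat_pow_closed[OF x]] by simp
  qed
  then have "d dvd m" by (intro affine_powers_commute_law laws_hold_in_affine)
  moreover have "0 < m" using m d_gt_1 by (cases m) simp_all
  ultimately have "d \<le> m" by (rule dvd_imp_le)
  with m s(1) \<open>0 < m\<close> have s1: "s = 1" by (cases s) auto
  \<comment> \<open>As \<open>p\<close> is \<open>1\<close> modulo \<open>d\<close>, the \<open>p\<close>-th power still acts as \<open>q\<close>.\<close>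
  have t: "k [^] p \<in> carrier G" "(k [^] p) [^] d = \<one>"
    using k(1) pow_dp[OF k(1)] by (simp_all add: nat_pow_pow mult.commute)
  have "k [^] p \<otimes> n \<otimes> inv (k [^] p) = n [^] ((q ^ s) ^ p)" by (rule conj_iterate[OF k(1) nc k(2)])
  also have "\<dots> = n [^] (q ^ 1)"
  proof (rule N_pow_cong[OF n(1)])
    have "[q ^ p = q ^ 1] (mod p)" unfolding pow_q_cong_iff by (rule p_cong_1)
    then show "[(q ^ s) ^ p = q ^ 1] (mod p)" by (simp add: s1)
  qed
  finally have rel: "k [^] p \<otimes> n \<otimes> inv (k [^] p) = n [^] q" by simp
  have np: "n [^] p = \<one>" using n(1) by (simp add: N_def)
  define f where "f = (\<lambda>(i::nat, j::nat). n [^] i \<otimes> (k [^] p) [^] j)"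
  note emb = affine_embedding[OF is_group nc t(1) np t(2) rel n(2), folded f_def]
  have sub: "f ` carrier affine_group \<subseteq> carrier G" using emb(1) unfolding hom_def by blast
  have "card (f ` carrier affine_group) = card (carrier G)"
    using card_image[OF emb(2)] order_affine ord by (simp only: order_def)
  then have "f ` carrier affine_group = carrier G" by (rule card_subset_eq[OF fin sub])
  then have "f \<in> iso affine_group G" unfolding iso_def bij_betw_def using emb by simp
  then show ?thesis unfolding is_iso_def by blast
qed

end

text \<open>
  The group \<open>H\<close> and the affine group have copies in the same pseudovariety, so each inherits the
  laws that define or generate it.
\<close>

lemma (in affine_params) generating_metab_group_of_generator:
  fixes H :: "'b monoid"
  assumes H: "group H" "finite (carrier H)" and gen: "pv_generated H = Ab p \<^bold>* Ab d"
  shows "generating_metab_group p d q H"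
proof -
  interpret group H by fact
  have 1: "satisfies H l" if l: "l \<in> metab_laws p d" for l
  proof -
    obtain K :: "nat monoid" where K: "group K" "finite (carrier K)" "H \<cong> K"
      by (rule ex_nat_copy[OF H])
    then have "K \<in> Ab p \<^bold>* Ab d" using pv_generated_contains[OF H(1) K(1,3)] gen by simp
    then have "satisfies K l" using l unfolding pv_product_Ab_metab_laws by blast
    then show ?thesis by (rule satisfies_iso[OF H(1) K(1,3)])
  qed
  have 2: "satisfies affine_group l" if l: "satisfies H l" for l :: "gens word \<times> gens word"
  proof -
    have "finite (carrier affine_group)" by simp
    then obtain K :: "nat monoid" where K: "group K" "finite (carrier K)" "affine_group \<cong> K"
      by (rule ex_nat_copy[OF group_affine])
    then have "K \<in> pv_generated H"
      using pv_generated_contains[OF group_affine K(1,3)] gen pv_product_eq_pv_generated_affine by simp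
    from satisfies_iso[OF group_affine K(1,3) satisfies_pv_generated[OF H(1) l this]] show ?thesis .
  qed
  show ?thesis by unfold_locales (use 1 2 H in blast)+
qed

theorem proposition4p5:
  fixes p d q :: nat
  assumes "prime p" and "p > 2"
    and "d > 1" and "d dvd p - 1"
    and "q \<in> {1..p - 1}" and "ord p q = d"
  shows "Ab p \<^bold>* Ab d = pv_generated (G_pd p d q) \<and>
         min_generator (Ab p \<^bold>* Ab d) (G_pd p d q) \<and>
         (\<forall>H :: 'b monoid. min_generator (Ab p \<^bold>* Ab d) H \<longrightarrow> H \<cong> G_pd p d q)"
proof -
  interpret affine_params p d q using assms by unfold_locales
  let ?G = "G_pd p d q"
  note G = G_pd_iso_affine
  have finA: "finite (carrier affine_group)" by simp
  have ordG: "order ?G = p * d" using iso_same_order G(2) order_affine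
    by (metis is_iso_def ex_in_conv)
  then have finG: "finite (carrier ?G)"
    using p_gt_1 d_gt_1 by (intro card_ge_0_finite) (simp flip: order_def)
  have gen: "Ab p \<^bold>* Ab d = pv_generated ?G"
    unfolding pv_product_eq_pv_generated_affine
    by (rule pv_generated_iso[OF group_affine G(1) finA finG G(2)])
  \<comment> \<open>Polymorphic because it is applied to groups on the natural numbers and to groups on \<open>'b\<close>.\<close>
  have min: "p * d \<le> order H" if "group H" "finite (carrier H)" "pv_generated H = Ab p \<^bold>* Ab d"
    for H :: "'c monoid"
    using generating_metab_group.order_ge[OF generating_metab_group_of_generator[OF that]] .
  have "min_generator (Ab p \<^bold>* Ab d) ?G"
    unfolding min_generator_def ordG using G(1) finG gen min by metis
  moreover have "H \<cong> ?G" if H: "min_generator (Ab p \<^bold>* Ab d) H" for H :: "'b monoid"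
  proof -
    have gH: "group H" and fH: "finite (carrier H)" and H_gen: "pv_generated H = Ab p \<^bold>* Ab d"
      and H_min: "\<And>K :: nat monoid. group K \<Longrightarrow> finite (carrier K) \<Longrightarrow>
        pv_generated K = Ab p \<^bold>* Ab d \<Longrightarrow> order H \<le> order K"
      using H unfolding min_generator_def by blast+
    obtain K :: "nat monoid" where K: "group K" "finite (carrier K)" "affine_group \<cong> K"
      by (rule ex_nat_copy[OF group_affine finA])
    have "pv_generated K = Ab p \<^bold>* Ab d"
      unfolding pv_product_eq_pv_generated_affine
      using pv_generated_iso[OF group_affine K(1) finA K(2,3)] by simp
    then have "order H \<le> order K" by (rule H_min[OF K(1,2)])
    also have "order K = p * d" using iso_same_order K(3) order_affine
      by (metis is_iso_def ex_in_conv)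
    finally have "order H = p * d" using min[OF gH fH H_gen] by simp
    then have "affine_group \<cong> H"
      by (rule generating_metab_group.iso_affine_of_order[OF generating_metab_group_of_generator[OF gH fH H_gen]])
    then have "H \<cong> affine_group" by (rule group.iso_sym[OF group_affine])
    then show ?thesis using G(2) by (rule iso_trans)
  qed
  ultimately show ?thesis using gen by blast
qed

end
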